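(* Let $E=\mathbb{R}^n$, let $I=I^r=[-r,0]$ for some $0<r<\infty$ or $I=I^\infty=(-\infty,0]$, and let $$H=C^{0,1}_{\mathrm{loc}}(I,E)_{\mathrm{co}},\qquad\bar H=C(I,E)_{\mathrm{co}}.$$ Let $f\colon\mathbb{R}\times E\times E\supset\mathrm{dom}(f)\to E$ and $\tau\colon\mathbb{R}\times H\supset D\to\mathbb{R}_+$ be maps with $\tau(t,\phi)\in-I$ for all $(t,\phi)\in D$. Suppose that (i) $f$ is continuous and $\mathrm{dom}(f)$ is open in $\mathbb{R}\times E\times E$, and (ii) there exists a continuous map $\bar\tau\colon\mathbb{R}\times\bar H\supset\bar D\to\mathbb{R}_+$, with $\bar\tau(t,\phi)\in-I$ for all $(t,\phi)\in\bar D$, such that $\bar\tau$ is an extension of $\tau$ with $D=\bar D\cap(\mathbb{R}\times H)$, and $\bar D$ is open in $\mathbb{R}\times\bar H$. If $f$ is locally Lipschitzian, and if $\bar\tau$ is almost locally Lipschitzian, then the initial value problem $$\dot x(t)=F(t,I_tx)\quad(t\ge t_0),\qquad I_{t_0}x=\phi_0,\qquad(t_0,\phi_0)\in\mathrm{dom}(F),$$ for $F:=F_{f,\tau}$ is maximally well-posed for $C^1$-solutions, where $$\mathrm{dom}(F_{f,\tau})=\{(t,\phi)\in D:(t,\phi(0),\phi(-\tau(t,\phi)))\in\mathrm{dom}(f)\},\qquad F_{f,\tau}(t,\phi)=f\bigl(t,\phi(0),\phi(-\tau(t,\phi))\bigr).$$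
   Context: Notation. $\mathbb{R}_+=[0,\infty)$; $-I=\{-\theta:\theta\in I\}$. $C(I,E)$ is the space of continuous maps $I\to E$ and $C^{0,1}_{\mathrm{loc}}(I,E)$ its subspace of locally Lipschitz maps; the subscript $\mathrm{co}$ means the compact-open topology (uniform convergence on compact subsets of $I$; the topology of uniform convergence if $I=I^r$). $\mathrm{lip}(g)$ is the least Lipschitz constant of $g$. For an interval $J$, $J+I=\{t+\theta:t\in J,\theta\in I\}$; for $x\colon J+I\to E$ and $t\in J$, $I_tx\colon I\to E$ is $I_tx(\theta)=x(t+\theta)$. $f$ is locally Lipschitzian if every point of $\mathrm{dom}(f)$ has a neighborhood $U$ in $\mathrm{dom}(f)$ and an $L>0$ with $\|f(t,x_1,y_1)-f(t,x_2,y_2)\|_E\le L(\|x_1-x_2\|_E+\|y_1-y_2\|_E)$ for all $(t,x_1,y_1),(t,x_2,y_2)\in U$. $\bar\tau$ is almost locally Lipschitzian if for every $(\sigma_0,\psi_0)\in\bar D$ the following holds. Case $I=I^r$: for every $M>0$ there are a neighborhood $W$ of $(\sigma_0,\psi_0)$ in $\mathbb{R}\times\bar H$ and $L>0$ with $|\bar\tau(t,\phi_1)-\bar\tau(t,\phi_2)|\le L\|\phi_1-\phi_2\|_\infty$ for all $(t,\phi_1),(t,\phi_2)\in W\cap\bar D$ with $\mathrm{lip}(\phi_1),\mathrm{lip}(\phi_2)\le M$. Case $I=I^\infty$: for every sequence $(M_k)_{k\ge1}$ of positive numbers there are a neighborhood $W$ of $(\sigma_0,\psi_0)$ in $\mathbb{R}\times\bar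 H$ and $L>0$ such that the same inequality holds for all $(t,\phi_1),(t,\phi_2)\in W\cap\bar D$ for which $\mathrm{supp}(\phi_1-\phi_2)$ is compact and $\mathrm{lip}(\phi_i|_{[-k,0]})\le M_k$ for all $k\ge1$, $i=1,2$. Solutions. For $(t_0,\phi_0)\in\mathrm{dom}(F)$, a solution of the initial value problem is a map $x\colon J+I\to E$, $J$ a non-degenerate interval with left end point $t_0\in J$, such that $I_{t_0}x=\phi_0$, $(t,I_tx)\in\mathrm{dom}(F)$ for all $t\in J$, and $x|_J$ is differentiable with $(x|_J)'(t)=F(t,I_tx)$ for all $t\in J$. It is a $C^1$-solution if $x|_J$ is $C^1$. $C^1$-solutions $x_i\colon J_i+I\to E$ are partially ordered by: $x_1\le x_2$ iff $J_1\subset J_2$ and $x_1|_{J_1}=x_2|_{J_1}$; a maximal $C^1$-solution is a maximal element. Maximal well-posedness. A maximal semiflow in a topological space $X$ is a map $\varPhi\colon\mathbb{R}_+\times X\supset\mathrm{dom}(\varPhi)\to X$ such that (1) $\mathrm{dom}(\varPhi)=\bigcup_{x\in X}[0,T(x))\times\{x\}$ for some function $T\colon X\to(0,\infty]$; (2) $\varPhi(0,x)=x$; (3) if $(t_1,x)\in\mathrm{dom}(\varPhi)$ and $(t_2,\varPhi(t_1,x))\in\mathrm{dom}(\varPhi)$, then $(t_1+t_2,x)\in\mathrm{dom}(\varPhi)$ and $\varPhi(t_1+t_2,x)=\varPhi(t_2,\varPhi(t_1,x))$. It is a continuous maximal semiflow if moreover $\mathrm{dom}(\varPhi)$ is open in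 $\mathbb{R}_+\times X$ and $\varPhi$ is continuous. For $\varOmega\subset\mathbb{R}\times X$ (subspace topology), a map $\mathcal{P}\colon\mathbb{R}_+\times\varOmega\supset\mathrm{dom}(\mathcal{P})\to X$ is a continuous maximal process in $\varOmega$ if $\overline{\mathcal{P}}(s,(t,x))=(t+s,\mathcal{P}(s,t,x))$ on $\mathrm{dom}(\mathcal{P})$ defines a continuous maximal semiflow in $\varOmega$. The initial value problem is maximally well-posed for $C^1$-solutions if (1) for every $(t_0,\phi_0)\in\mathrm{dom}(F)$ there is a unique maximal $C^1$-solution $x_F(\cdot;t_0,\phi_0)\colon[t_0,t_0+T_F(t_0,\phi_0))+I\to E$ with $0<T_F(t_0,\phi_0)\le\infty$; and (2) the solution process $\mathcal{P}_F$, with $\mathrm{dom}(\mathcal{P}_F)=\bigcup_{(t_0,\phi_0)\in\mathrm{dom}(F)}[0,T_F(t_0,\phi_0))\times\{(t_0,\phi_0)\}$ and $\mathcal{P}_F(s,t_0,\phi_0)=I_{t_0+s}[x_F(\cdot;t_0,\phi_0)]\in H$, is a continuous maximal process in $\mathrm{dom}(F)$. *)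

theory Defs
  imports "HOL-Analysis.Analysis"
begin

text \<open>Maps defined on a set \<open>S\<close> of reals are represented by functions in \<^term>\<open>extensional S\<close>
  (equal to \<^term>\<open>undefined\<close> outside \<open>S\<close>), so that equality of maps is equality in HOL.\<close>

definition cont_maps :: "real set \<Rightarrow> (real \<Rightarrow> 'a::metric_space) set"
  where "cont_maps I = {\<phi> \<in> extensional I. continuous_on I \<phi>}"

definition loc_lipschitz_on :: "real set \<Rightarrow> (real \<Rightarrow> 'a::metric_space) \<Rightarrow> bool"
  where "loc_lipschitz_on I \<phi> \<longleftrightarrow> (\<forall>\<theta>\<in>I. \<exists>u>0. \<exists>L. L-lipschitz_on (cball \<theta> u \<inter> I) \<phi>)"

definition compact_open :: "real set \<Rightarrow> (real \<Rightarrow> 'a::metric_space) topology"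
  where "compact_open I =
    topology_generated_by
      {{\<phi> \<in> cont_maps I. \<phi> ` K \<subseteq> U} | K U. compact K \<and> K \<subseteq> I \<and> open U}"

abbreviation Hbar :: "real set \<Rightarrow> (real \<Rightarrow> 'a::metric_space) topology"
  where "Hbar I \<equiv> compact_open I"

abbreviation H :: "real set \<Rightarrow> (real \<Rightarrow> 'a::metric_space) topology"
  where "H I \<equiv> subtopology (compact_open I) {\<phi>. loc_lipschitz_on I \<phi>}"

lemma topspace_compact_open [simp]: "topspace (compact_open I) = cont_maps I"
  unfolding compact_open_def topology_generated_by_topspace by blast

text \<open>The compact-open topology is the topology of uniform convergence on compact subsets.\<close>

lemma openin_compact_open:
  "openin (compact_open I) W \<longleftrightarrow>
    W \<subseteq> cont_maps I \<and>
    (\<forall>\<phi>\<in>W. \<exists>K e. compact K \<and> K \<subseteq> I \<and> 0 < e \<and>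
      (\<forall>\<psi>\<in>cont_maps I. (\<forall>\<theta>\<in>K. dist (\<psi> \<theta>) (\<phi> \<theta>) < e) \<longrightarrow> \<psi> \<in> W))"
  (is "_ \<longleftrightarrow> _ \<and> ?P W")
proof
  assume W: "openin (compact_open I) W"
  have "?P W"
    using W[unfolded compact_open_def openin_topology_generated_by_iff]
  proof (induction rule: generate_topology_on.induct)
    case Empty
    then show ?case by simp
  next
    case (Int A B)
    show ?case
    proof
      fix \<phi> assume "\<phi> \<in> A \<inter> B"
      then obtain K e K' e' where
        "compact K" "K \<subseteq> I" "0 < e"
        "\<forall>\<psi>\<in>cont_maps I. (\<forall>\<theta>\<in>K. dist (\<psi> \<theta>) (\<phi> \<theta>) < e) \<longrightarrow> \<psi> \<in> A"
        "compact K'" "K' \<subseteq> I" "0 < e'"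
        "\<forall>\<psi>\<in>cont_maps I. (\<forall>\<theta>\<in>K'. dist (\<psi> \<theta>) (\<phi> \<theta>) < e') \<longrightarrow> \<psi> \<in> B"
        using Int.IH by (metis IntD1 IntD2)
      then show "\<exists>K e. compact K \<and> K \<subseteq> I \<and> 0 < e \<and>
          (\<forall>\<psi>\<in>cont_maps I. (\<forall>\<theta>\<in>K. dist (\<psi> \<theta>) (\<phi> \<theta>) < e) \<longrightarrow> \<psi> \<in> A \<inter> B)"
        by (intro exI[of _ "K \<union> K'"] exI[of _ "min e e'"]) auto
    qed
  next
    case (UN \<A>)
    show ?case
    proof
      fix \<phi> assume "\<phi> \<in> \<Union>\<A>"
      then obtain A where A: "A \<in> \<A>" "\<phi> \<in> A" by blast
      then obtain K e where "compact K" "K \<subseteq> I" "0 < e"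
        "\<forall>\<psi>\<in>cont_maps I. (\<forall>\<theta>\<in>K. dist (\<psi> \<theta>) (\<phi> \<theta>) < e) \<longrightarrow> \<psi> \<in> A"
        using UN.IH by metis
      with A show "\<exists>K e. compact K \<and> K \<subseteq> I \<and> 0 < e \<and>
          (\<forall>\<psi>\<in>cont_maps I. (\<forall>\<theta>\<in>K. dist (\<psi> \<theta>) (\<phi> \<theta>) < e) \<longrightarrow> \<psi> \<in> \<Union>\<A>)"
        by (intro exI[of _ K] exI[of _ e]) auto
    qed
  next
    case (Basis A)
    then obtain K U where KU: "A = {\<phi> \<in> cont_maps I. \<phi> ` K \<subseteq> U}" "compact K" "K \<subseteq> I" "open U"
      by blast
    show ?case
    proof
      fix \<phi> assume \<phi>: "\<phi> \<in> A"
      have "compact (\<phi> ` K)"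
        using \<phi> KU by (intro compact_continuous_image)
          (auto simp: cont_maps_def intro: continuous_on_subset)
      moreover have "\<phi> ` K \<subseteq> U"
        using \<phi> KU by blast
      ultimately obtain e where e: "e > 0" "(\<Union>x\<in>\<phi> ` K. ball x e) \<subseteq> U"
        using compact_subset_open_imp_ball_epsilon_subset[OF _ \<open>open U\<close>] by metis
      then show "\<exists>K e. compact K \<and> K \<subseteq> I \<and> 0 < e \<and>
          (\<forall>\<psi>\<in>cont_maps I. (\<forall>\<theta>\<in>K. dist (\<psi> \<theta>) (\<phi> \<theta>) < e) \<longrightarrow> \<psi> \<in> A)"
        using KU by (intro exI[of _ K] exI[of _ e]) (force simp: dist_commute)
    qed
  qed
  with openin_subset[OF W] show "W \<subseteq> cont_maps I \<and> ?P W"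
    by simp
next
  assume W: "W \<subseteq> cont_maps I \<and> ?P W"
  show "openin (compact_open I) W"
  proof (subst openin_subopen, intro ballI)
    fix \<phi> assume "\<phi> \<in> W"
    with W obtain K e where K: "compact K" "K \<subseteq> I" "0 < e"
      and e: "\<And>\<psi>. \<psi> \<in> cont_maps I \<Longrightarrow> (\<And>\<theta>. \<theta> \<in> K \<Longrightarrow> dist (\<psi> \<theta>) (\<phi> \<theta>) < e) \<Longrightarrow> \<psi> \<in> W"
      by meson
    have \<phi>: "\<phi> \<in> cont_maps I" using W \<open>\<phi> \<in> W\<close> by blast
    then have "continuous_on K \<phi>"
      using K by (auto simp: cont_maps_def intro: continuous_on_subset)
    then have "uniformly_continuous_on K \<phi>"
      using K compact_uniformly_continuous by blast
    then obtain d where d: "d > 0"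
      "\<And>x y. x \<in> K \<Longrightarrow> y \<in> K \<Longrightarrow> dist y x < d \<Longrightarrow> dist (\<phi> y) (\<phi> x) < e / 2"
      using K unfolding uniformly_continuous_on_def by (metis half_gt_zero)
    obtain F where F: "finite F" "F \<subseteq> K" "K \<subseteq> (\<Union>x\<in>F. ball x (d/2))"
      using compactE_image[OF \<open>compact K\<close>, of K "\<lambda>x. ball x (d/2)"] d by force
    define B where "B x = {\<psi> \<in> cont_maps I. \<psi> ` (K \<inter> cball x (d/2)) \<subseteq> ball (\<phi> x) (e/2)}" for x
    have B: "openin (compact_open I) (B x)" for x
      unfolding compact_open_def B_def using K
      by (intro topology_generated_by_Basis CollectI exI[of _ "K \<inter> cball x (d/2)"]
          exI[of _ "ball (\<phi> x) (e/2)"]) auto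
    let ?T = "cont_maps I \<inter> (\<Inter>x\<in>F. B x)"
    have "openin (compact_open I) ?T"
      using openin_INT[OF F(1), of "compact_open I" B] B
      by (simp add: Int_commute)
    moreover have "\<phi> \<in> ?T"
      using \<phi> F d by (force simp: B_def dist_commute)
    moreover have "?T \<subseteq> W"
    proof
      fix \<psi> assume \<psi>: "\<psi> \<in> ?T"
      show "\<psi> \<in> W"
      proof (rule e)
        fix \<theta> assume "\<theta> \<in> K"
        then obtain x where x: "x \<in> F" "\<theta> \<in> ball x (d/2)" using F by blast
        then have "\<psi> \<in> B x" using \<psi> by blast
        then have "\<psi> \<theta> \<in> ball (\<phi> x) (e/2)"
          using x \<open>\<theta> \<in> K\<close> unfolding B_def by (auto simp: image_subset_iff)
        then have "dist (\<psi> \<theta>) (\<phi> x) < e / 2" by (simp add: dist_commute)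
        moreover have "dist (\<phi> \<theta>) (\<phi> x) < e / 2"
          using d x F \<open>\<theta> \<in> K\<close> by (intro d(2)) (auto simp: dist_commute)
        ultimately show "dist (\<psi> \<theta>) (\<phi> \<theta>) < e"
          using dist_triangle2[of "\<psi> \<theta>" "\<phi> \<theta>" "\<phi> x"] by linarith
      qed (use \<psi> in blast)
    qed
    ultimately show "\<exists>T. openin (compact_open I) T \<and> \<phi> \<in> T \<and> T \<subseteq> W" by blast
  qed
qed

definition seg :: "real set \<Rightarrow> real \<Rightarrow> (real \<Rightarrow> 'a) \<Rightarrow> real \<Rightarrow> 'a"
  where "seg I t x = restrict (\<lambda>\<theta>. x (t + \<theta>)) I"

text \<open>Least Lipschitz constant; \<open>\<infinity>\<close> for maps that are not Lipschitz.\<close>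

definition lip :: "real set \<Rightarrow> (real \<Rightarrow> 'a::metric_space) \<Rightarrow> ereal"
  where "lip S g = Inf {ereal L | L. L-lipschitz_on S g}"

definition locally_lipschitzian ::
  "(real \<times> 'a \<times> 'a) set \<Rightarrow> (real \<times> 'a \<times> 'a \<Rightarrow> 'a::real_normed_vector) \<Rightarrow> bool"
  where "locally_lipschitzian A f \<longleftrightarrow>
    (\<forall>p\<in>A. \<exists>U L. openin (top_of_set A) U \<and> p \<in> U \<and> L > 0 \<and>
      (\<forall>t x1 y1 x2 y2. (t, x1, y1) \<in> U \<longrightarrow> (t, x2, y2) \<in> U \<longrightarrow>
        norm (f (t, x1, y1) - f (t, x2, y2)) \<le> L * (norm (x1 - x2) + norm (y1 - y2))))"

text \<open>In the noncompact case the supremum is only used for differences with compact support, and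
  the support, a closure relative to the closed set \<open>I\<close>, is the closure in the real line.\<close>

definition almost_locally_lipschitzian ::
  "real set \<Rightarrow> (real \<times> (real \<Rightarrow> 'a)) set \<Rightarrow> (real \<times> (real \<Rightarrow> 'a::real_normed_vector) \<Rightarrow> real) \<Rightarrow> bool"
  where "almost_locally_lipschitzian I D \<tau> \<longleftrightarrow>
    (\<forall>p\<in>D.
      if I = {..0} then
        \<forall>M::nat \<Rightarrow> real. (\<forall>k\<ge>1. M k > 0) \<longrightarrow>
          (\<exists>W L. openin (prod_topology euclideanreal (Hbar I)) W \<and> p \<in> W \<and> L > 0 \<and>
            (\<forall>t \<phi>1 \<phi>2. (t, \<phi>1) \<in> W \<inter> D \<longrightarrow> (t, \<phi>2) \<in> W \<inter> D \<longrightarrow>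
              compact (closure {\<theta>\<in>I. \<phi>1 \<theta> - \<phi>2 \<theta> \<noteq> 0}) \<longrightarrow>
              (\<forall>k\<ge>1. lip {- real k..0} \<phi>1 \<le> ereal (M k) \<and> lip {- real k..0} \<phi>2 \<le> ereal (M k)) \<longrightarrow>
              \<bar>\<tau> (t, \<phi>1) - \<tau> (t, \<phi>2)\<bar> \<le> L * (SUP \<theta>\<in>I. norm (\<phi>1 \<theta> - \<phi>2 \<theta>))))
      else
        \<forall>M>0.
          (\<exists>W L. openin (prod_topology euclideanreal (Hbar I)) W \<and> p \<in> W \<and> L > 0 \<and>
            (\<forall>t \<phi>1 \<phi>2. (t, \<phi>1) \<in> W \<inter> D \<longrightarrow> (t, \<phi>2) \<in> W \<inter> D \<longrightarrow>
              lip I \<phi>1 \<le> ereal M \<longrightarrow> lip I \<phi>2 \<le> ereal M \<longrightarrow>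
              \<bar>\<tau> (t, \<phi>1) - \<tau> (t, \<phi>2)\<bar> \<le> L * (SUP \<theta>\<in>I. norm (\<phi>1 \<theta> - \<phi>2 \<theta>)))))"

text \<open>The initial value problem is given by \<open>F\<close> on the domain \<open>A\<close>. A solution \<open>x: J + I \<rightarrow> E\<close> is the
  pair \<open>(J, x)\<close> with \<open>x\<close> extensional on the Minkowski sum \<open>J + I\<close>.\<close>

definition solution ::
  "real set \<Rightarrow> (real \<times> (real \<Rightarrow> 'a)) set \<Rightarrow> (real \<times> (real \<Rightarrow> 'a) \<Rightarrow> 'a::real_normed_vector) \<Rightarrow>
    real \<times> (real \<Rightarrow> 'a) \<Rightarrow> real set \<times> (real \<Rightarrow> 'a) \<Rightarrow> bool"
  where "solution I A F = (\<lambda>(t0, \<phi>0) (J, x).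
    is_interval J \<and> t0 \<in> J \<and> (\<forall>t\<in>J. t0 \<le> t) \<and> J \<noteq> {t0} \<and>
    x \<in> extensional (J + I) \<and>
    seg I t0 x = \<phi>0 \<and>
    (\<forall>t\<in>J. (t, seg I t x) \<in> A) \<and>
    (\<forall>t\<in>J. (x has_vector_derivative F (t, seg I t x)) (at t within J)))"

definition C1_solution ::
  "real set \<Rightarrow> (real \<times> (real \<Rightarrow> 'a)) set \<Rightarrow> (real \<times> (real \<Rightarrow> 'a) \<Rightarrow> 'a::real_normed_vector) \<Rightarrow>
    real \<times> (real \<Rightarrow> 'a) \<Rightarrow> real set \<times> (real \<Rightarrow> 'a) \<Rightarrow> bool"
  where "C1_solution I A F p = (\<lambda>(J, x).
    solution I A F p (J, x) \<and>
    (\<exists>x'. continuous_on J x' \<and> (\<forall>t\<in>J. (x has_vector_derivative x' t) (at t within J))))"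

definition sol_le :: "real set \<times> (real \<Rightarrow> 'a) \<Rightarrow> real set \<times> (real \<Rightarrow> 'a) \<Rightarrow> bool"
  where "sol_le = (\<lambda>(J1, x1) (J2, x2). J1 \<subseteq> J2 \<and> (\<forall>t\<in>J1. x1 t = x2 t))"

definition maximal_C1_solution ::
  "real set \<Rightarrow> (real \<times> (real \<Rightarrow> 'a)) set \<Rightarrow> (real \<times> (real \<Rightarrow> 'a) \<Rightarrow> 'a::real_normed_vector) \<Rightarrow>
    real \<times> (real \<Rightarrow> 'a) \<Rightarrow> real set \<times> (real \<Rightarrow> 'a) \<Rightarrow> bool"
  where "maximal_C1_solution I A F p s \<longleftrightarrow>
    C1_solution I A F p s \<and> (\<forall>s'. C1_solution I A F p s' \<longrightarrow> sol_le s s' \<longrightarrow> s' = s)"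

definition maximal_semiflow :: "'x topology \<Rightarrow> (real \<times> 'x) set \<Rightarrow> (real \<times> 'x \<Rightarrow> 'x) \<Rightarrow> bool"
  where "maximal_semiflow X A \<Phi> \<longleftrightarrow>
    \<Phi> \<in> A \<rightarrow> topspace X \<and>
    (\<exists>T :: 'x \<Rightarrow> ereal. (\<forall>x\<in>topspace X. 0 < T x) \<and>
      A = {(t, x). x \<in> topspace X \<and> 0 \<le> t \<and> ereal t < T x}) \<and>
    (\<forall>x\<in>topspace X. \<Phi> (0, x) = x) \<and>
    (\<forall>t1 t2 x. (t1, x) \<in> A \<longrightarrow> (t2, \<Phi> (t1, x)) \<in> A \<longrightarrow>
      (t1 + t2, x) \<in> A \<and> \<Phi> (t1 + t2, x) = \<Phi> (t2, \<Phi> (t1, x)))"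

definition continuous_maximal_semiflow ::
  "'x topology \<Rightarrow> (real \<times> 'x) set \<Rightarrow> (real \<times> 'x \<Rightarrow> 'x) \<Rightarrow> bool"
  where "continuous_maximal_semiflow X A \<Phi> \<longleftrightarrow>
    maximal_semiflow X A \<Phi> \<and>
    openin (prod_topology (top_of_set {0..}) X) A \<and>
    continuous_map (subtopology (prod_topology (top_of_set {0..}) X) A) X \<Phi>"

definition continuous_maximal_process ::
  "'x topology \<Rightarrow> (real \<times> 'x) set \<Rightarrow> (real \<times> real \<times> 'x) set \<Rightarrow> (real \<times> real \<times> 'x \<Rightarrow> 'x) \<Rightarrow> bool"
  where "continuous_maximal_process X \<Omega> A P \<longleftrightarrow>
    continuous_maximal_semiflow (subtopology (prod_topology euclideanreal X) \<Omega>) A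
      (\<lambda>(s, t, x). (t + s, P (s, t, x)))"

text \<open>\<open>T\<close> and \<open>X\<close> are the functions \<open>T\<^sub>F\<close> and \<open>x\<^sub>F\<close>; the equivalence in the first part says that the
  solution \<open>X p\<close> on \<open>[t0, t0 + T p) + I\<close> is the unique maximal one and so determines
  them on the domain.\<close>

definition maximally_well_posed_C1 ::
  "real set \<Rightarrow> (real \<times> (real \<Rightarrow> 'a)) set \<Rightarrow> (real \<times> (real \<Rightarrow> 'a) \<Rightarrow> 'a::real_normed_vector) \<Rightarrow> bool"
  where "maximally_well_posed_C1 I A F \<longleftrightarrow>
    (\<exists>(T :: real \<times> (real \<Rightarrow> 'a) \<Rightarrow> ereal) (X :: real \<times> (real \<Rightarrow> 'a) \<Rightarrow> real \<Rightarrow> 'a).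
      (\<forall>p\<in>A. 0 < T p \<and>
        (\<forall>s. maximal_C1_solution I A F p s \<longleftrightarrow>
          s = ({t. fst p \<le> t \<and> ereal t < ereal (fst p) + T p}, X p))) \<and>
      continuous_maximal_process (H I) A
        {(s, p). p \<in> A \<and> 0 \<le> s \<and> ereal s < T p}
        (\<lambda>(s, t0, \<phi>0). seg I (t0 + s) (X (t0, \<phi>0))))"

definition dom_F ::
  "(real \<times> 'a \<times> 'a) set \<Rightarrow> (real \<times> (real \<Rightarrow> 'a)) set \<Rightarrow> (real \<times> (real \<Rightarrow> 'a) \<Rightarrow> real) \<Rightarrow>
    (real \<times> (real \<Rightarrow> 'a)) set"
  where "dom_F domf D \<tau> = {(t, \<phi>) \<in> D. (t, \<phi> 0, \<phi> (- \<tau> (t, \<phi>))) \<in> domf}"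

definition F_of ::
  "(real \<times> 'a \<times> 'a \<Rightarrow> 'a) \<Rightarrow> (real \<times> (real \<Rightarrow> 'a) \<Rightarrow> real) \<Rightarrow> real \<times> (real \<Rightarrow> 'a) \<Rightarrow> 'a"
  where "F_of f \<tau> = (\<lambda>(t, \<phi>). f (t, \<phi> 0, \<phi> (- \<tau> (t, \<phi>))))"

end

theory Submission
  imports Defs "HOL-Complex_Analysis.Great_Picard"
begin

text \<open>The right-hand side \<open>F\<close> is continuous on an open set of states for the compact-open topology, but
  it need not be locally Lipschitz there: moving a history \<open>\<phi>\<close> changes the delay, and the value of \<open>\<phi>\<close> at
  the delayed argument changes with it at a rate given by the Lipschitz constant of \<open>\<phi>\<close>, which is
  not bounded on any nonempty open set. So the two usual tools are kept apart, and each is used where it is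
  available.

  Uniqueness uses the Lipschitz estimate. Two solutions with the same initial state share their
  past, which is locally Lipschitz, and have bounded speed on compact intervals; hence their
  segments have common Lipschitz constants and differ on a bounded set. Along such segments the almost
  locally Lipschitzian delay makes \<open>F\<close> Lipschitz (lemma \<open>delay_problem_state_dependent\<close>), and the
  classical argument applies (lemmas \<open>local_uniqueness\<close> and \<open>solves_unique\<close>).

  Existence and continuous dependence use compactness instead of a contraction, whose constant would
  depend on the Lipschitz constant of the initial history. Continuity of \<open>F\<close> alone gives a
  neighbourhood of each state and a time \<open>\<delta>\<close> such that all continuations with speed at most \<open>B\<close> of
  histories in this neighbourhood stay during \<open>\<delta>\<close> where \<open>F\<close> is bounded by \<open>B\<close>
  (lemma \<open>trapped_nearby\<close>). Approximate solutions of this kind have subsequences that converge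
  to solutions (lemma \<open>limit_of_approximations\<close>). Applied to delayed integral equations this gives
  a solution on the whole of \<open>{0..\<delta>}\<close>; applied to solutions with converging initial states it gives,
  together with uniqueness, continuous dependence on a time interval that is locally uniform in
  the state (lemma \<open>dependence_local\<close>). The latter extends step by step along
  any solution (lemma \<open>dependence\<close>).

  The rest is formal. Local existence continues every solution on a compact interval, so the solutions
  from \<open>p\<close> exist exactly on the intervals \<open>{0..b}\<close> with \<open>b\<close> less than a lifetime, uniqueness glues
  them to a greatest solution, and \<open>dependence\<close> makes the lifetime lower semicontinuous and the
  solution process continuous.

  Throughout, the pair of an instant and a history is called a state.\<close>

section \<open>Histories and their neighbourhoods\<close>

definition history_interval :: "real set \<Rightarrow> bool"
  where "history_interval I \<longleftrightarrow> (\<exists>r>0. I = {-r..0}) \<or> I = {..0}"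

lemma history_intervalD:
  assumes "history_interval I"
  shows "closed I" "0 \<in> I" "\<And>\<theta>. \<theta> \<in> I \<Longrightarrow> \<theta> \<le> 0"
    "\<And>\<theta> \<eta>. \<theta> \<in> I \<Longrightarrow> \<theta> \<le> \<eta> \<Longrightarrow> \<eta> \<le> 0 \<Longrightarrow> \<eta> \<in> I"
    "compact (I \<inter> {-c..0})"
proof -
  show cl: "closed I" and "0 \<in> I" "\<And>\<theta>. \<theta> \<in> I \<Longrightarrow> \<theta> \<le> 0"
    "\<And>\<theta> \<eta>. \<theta> \<in> I \<Longrightarrow> \<theta> \<le> \<eta> \<Longrightarrow> \<eta> \<le> 0 \<Longrightarrow> \<eta> \<in> I"
    using assms by (auto simp: history_interval_def)
  show "compact (I \<inter> {-c..0})"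
    using cl by (simp add: closed_Int_compact)
qed

text \<open>A single parameter controls both the uniform distance and the compact part of \<open>I\<close> on which it
  is measured; so these sets shrink with \<open>e\<close> and satisfy a triangle inequality, like the balls of
  a metric.\<close>

definition nbd :: "real set \<Rightarrow> real \<Rightarrow> real \<times> (real \<Rightarrow> 'a::metric_space) \<Rightarrow> (real \<times> (real \<Rightarrow> 'a)) set"
  where "nbd I e p = {(s, \<psi>). \<psi> \<in> cont_maps I \<and> dist s (fst p) < e \<and>
    (\<forall>\<theta>\<in>I. - (1 / e) \<le> \<theta> \<longrightarrow> dist (\<psi> \<theta>) (snd p \<theta>) < e)}"

lemma nbd_self: "0 < e \<Longrightarrow> \<phi> \<in> cont_maps I \<Longrightarrow> (t, \<phi>) \<in> nbd I e (t, \<phi>)"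
  by (auto simp: nbd_def)

lemma nbd_mono:
  assumes "0 < d" "d \<le> e"
  shows "nbd I d p \<subseteq> nbd I e p"
proof -
  have "1 / e \<le> 1 / d" using assms by (simp add: frac_le)
  then show ?thesis using assms by (fastforce simp: nbd_def)
qed

lemma nbd_triangle:
  assumes "q \<in> nbd I d p" "p' \<in> nbd I e q" "0 < d" "0 < e"
  shows "p' \<in> nbd I (d + e) p"
proof -
  obtain s \<psi> where q: "q = (s, \<psi>)" by (cases q)
  obtain s' \<psi>' where p': "p' = (s', \<psi>')" by (cases p')
  have le: "1 / (d + e) \<le> 1 / d" "1 / (d + e) \<le> 1 / e"
    using assms by (simp_all add: frac_le)
  have "dist s' (fst p) < d + e"
    using assms(1,2) dist_triangle[of s' "fst p" s] unfolding q p' nbd_def by auto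
  moreover have "dist (\<psi>' \<theta>) (snd p \<theta>) < d + e" if "\<theta> \<in> I" "- (1 / (d + e)) \<le> \<theta>" for \<theta>
  proof -
    have "dist (\<psi> \<theta>) (snd p \<theta>) < d" "dist (\<psi>' \<theta>) (\<psi> \<theta>) < e"
      using assms(1,2) that le unfolding q p' nbd_def by auto
    then show ?thesis using dist_triangle[of "\<psi>' \<theta>" "snd p \<theta>" "\<psi> \<theta>"] by linarith
  qed
  moreover have "\<psi>' \<in> cont_maps I" using assms(2) unfolding p' by (simp add: nbd_def)
  ultimately show ?thesis unfolding p' by (simp add: nbd_def)
qed

text \<open>Openness needs an argument although the defining inequality is strict: on the compact set
  \<open>I \<inter> {- (1 / e)..0}\<close> the distance attains its maximum, so a margin below \<open>e\<close> is left.\<close>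

lemma openin_nbd:
  assumes I: "history_interval I" and \<phi>: "\<phi> \<in> cont_maps I" and e: "0 < e"
  shows "openin (prod_topology euclideanreal (Hbar I)) (nbd I e (t, \<phi>))"
proof -
  define K where "K = I \<inter> {- (1 / e)..0}"
  define V where "V = {\<psi> \<in> cont_maps I. \<forall>\<theta>\<in>K. dist (\<psi> \<theta>) (\<phi> \<theta>) < e}"
  have K: "compact K" "0 \<in> K"
    using history_intervalD(2,5)[OF I] e by (auto simp: K_def)
  have "openin (Hbar I) V"
    unfolding openin_compact_open
  proof (intro conjI ballI)
    show "V \<subseteq> cont_maps I" by (auto simp: V_def)
    fix \<psi> assume \<psi>: "\<psi> \<in> V"
    have "continuous_on K \<psi>" "continuous_on K \<phi>"
      using \<psi> \<phi> by (auto simp: V_def cont_maps_def K_def intro: continuous_on_subset)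
    then have "continuous_on K (\<lambda>\<theta>. dist (\<psi> \<theta>) (\<phi> \<theta>))"
      by (intro continuous_intros)
    then obtain m where m: "m \<in> K" "\<forall>\<theta>\<in>K. dist (\<psi> \<theta>) (\<phi> \<theta>) \<le> dist (\<psi> m) (\<phi> m)"
      using continuous_attains_sup[of K "\<lambda>\<theta>. dist (\<psi> \<theta>) (\<phi> \<theta>)"] K by auto
    have "0 < e - dist (\<psi> m) (\<phi> m)" using \<psi> m by (simp add: V_def)
    moreover have "\<xi> \<in> V" if \<xi>: "\<xi> \<in> cont_maps I"
      "\<forall>\<theta>\<in>K. dist (\<xi> \<theta>) (\<psi> \<theta>) < e - dist (\<psi> m) (\<phi> m)" for \<xi>
      unfolding V_def
    proof (intro CollectI conjI ballI)
      fix \<theta> assume "\<theta> \<in> K"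
      then show "dist (\<xi> \<theta>) (\<phi> \<theta>) < e"
        using \<xi>(2) m(2) dist_triangle[of "\<xi> \<theta>" "\<phi> \<theta>" "\<psi> \<theta>"] by fastforce
    qed (fact \<xi>(1))
    ultimately show "\<exists>K e. compact K \<and> K \<subseteq> I \<and> 0 < e \<and>
        (\<forall>\<xi>\<in>cont_maps I. (\<forall>\<theta>\<in>K. dist (\<xi> \<theta>) (\<psi> \<theta>) < e) \<longrightarrow> \<xi> \<in> V)"
      using K by (intro exI[of _ K] exI[of _ "e - dist (\<psi> m) (\<phi> m)"]) (auto simp: K_def)
  qed
  moreover have "nbd I e (t, \<phi>) = ball t e \<times> V"
    using history_intervalD(3)[OF I] by (fastforce simp: nbd_def V_def K_def dist_commute)
  ultimately show ?thesis
    by (simp add: openin_prod_Times_iff)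
qed

lemma nbd_subset_openin:
  assumes I: "history_interval I"
    and W: "openin (prod_topology euclideanreal (Hbar I)) W" "p \<in> W"
  obtains e where "0 < e" "nbd I e p \<subseteq> W"
proof -
  obtain t \<phi> where p: "p = (t, \<phi>)" by (cases p)
  with W obtain U V where U: "open U" "t \<in> U" and V: "openin (Hbar I) V" "\<phi> \<in> V"
    and UV: "U \<times> V \<subseteq> W"
    unfolding openin_prod_topology_alt by (metis open_openin)
  obtain e1 where e1: "0 < e1" "\<And>s. dist s t < e1 \<Longrightarrow> s \<in> U"
    using U by (auto simp: open_dist)
  obtain K e2 where K: "compact K" "K \<subseteq> I" and e2: "0 < e2"
    "\<And>\<psi>. \<psi> \<in> cont_maps I \<Longrightarrow> (\<And>\<theta>. \<theta> \<in> K \<Longrightarrow> dist (\<psi> \<theta>) (\<phi> \<theta>) < e2) \<Longrightarrow> \<psi> \<in> V"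
    using V unfolding openin_compact_open by meson
  obtain c where c: "0 < c" "\<And>\<theta>. \<theta> \<in> K \<Longrightarrow> norm \<theta> \<le> c"
    using compact_imp_bounded[OF K(1)] bounded_pos by metis
  define e where "e = Min {e1, e2, 1 / c}"
  have e: "0 < e" "e \<le> e1" "e \<le> e2" "e \<le> 1 / c"
    using e1 e2 c by (auto simp: e_def)
  have ec: "c \<le> 1 / e"
    using e c by (simp add: field_simps)
  have "nbd I e p \<subseteq> W"
  proof
    fix q assume q: "q \<in> nbd I e p"
    obtain s \<psi> where s: "q = (s, \<psi>)" by (cases q)
    have "s \<in> U" using q e by (intro e1) (auto simp: s p nbd_def)
    moreover have "\<psi> \<in> V"
    proof (rule e2(2))
      show "\<psi> \<in> cont_maps I" using q by (simp add: s nbd_def)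
      fix \<theta> assume "\<theta> \<in> K"
      then have "- (1 / e) \<le> \<theta>" "\<theta> \<in> I" using c(2)[of \<theta>] ec K by auto
      then show "dist (\<psi> \<theta>) (\<phi> \<theta>) < e2" using q e by (fastforce simp: s p nbd_def)
    qed
    ultimately show "q \<in> W" using UV s by blast
  qed
  with e show thesis by (intro that)
qed

lemma openin_subtopology_nbd:
  assumes I: "history_interval I" and A: "A \<subseteq> UNIV \<times> cont_maps I"
  shows "openin (subtopology (prod_topology euclideanreal (Hbar I)) A) W \<longleftrightarrow>
    W \<subseteq> A \<and> (\<forall>p\<in>W. \<exists>e>0. nbd I e p \<inter> A \<subseteq> W)"
proof
  assume "openin (subtopology (prod_topology euclideanreal (Hbar I)) A) W"
  then obtain W' where W': "openin (prod_topology euclideanreal (Hbar I)) W'" "W = W' \<inter> A"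
    unfolding openin_subtopology by blast
  have "\<exists>e>0. nbd I e p \<inter> A \<subseteq> W" if p: "p \<in> W" for p
  proof -
    have "p \<in> W'" using p W'(2) by simp
    then obtain e where "0 < e" "nbd I e p \<subseteq> W'"
      using nbd_subset_openin[OF I W'(1)] by metis
    then show ?thesis using W'(2) by (intro exI[of _ e]) auto
  qed
  moreover have "W \<subseteq> A" using W'(2) by simp
  ultimately show "W \<subseteq> A \<and> (\<forall>p\<in>W. \<exists>e>0. nbd I e p \<inter> A \<subseteq> W)" by simp
next
  assume W: "W \<subseteq> A \<and> (\<forall>p\<in>W. \<exists>e>0. nbd I e p \<inter> A \<subseteq> W)"
  show "openin (subtopology (prod_topology euclideanreal (Hbar I)) A) W"
  proof (subst openin_subopen, intro ballI)
    fix p assume p: "p \<in> W"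
    with W obtain e where e: "0 < e" "nbd I e p \<inter> A \<subseteq> W" by blast
    obtain t \<phi> where t: "p = (t, \<phi>)" "\<phi> \<in> cont_maps I" using p W A by blast
    have "openin (subtopology (prod_topology euclideanreal (Hbar I)) A) (nbd I e p \<inter> A)"
      unfolding t openin_subtopology using openin_nbd[OF I t(2) e(1)] by blast
    moreover have "p \<in> nbd I e p \<inter> A"
      using p W nbd_self[OF e(1) t(2)] t(1) by auto
    ultimately show "\<exists>T. openin (subtopology (prod_topology euclideanreal (Hbar I)) A) T \<and> p \<in> T \<and> T \<subseteq> W"
      using e by blast
  qed
qed

text \<open>A locally Lipschitz map on an unbounded \<open>I\<close> has no single Lipschitz constant. Recording one
  constant for each \<open>k\<close> treats bounded and unbounded histories alike; if \<open>I\<close> is bounded, then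
  all constants with large \<open>k\<close> refer to the whole of \<open>I\<close>.\<close>

definition lips :: "real set \<Rightarrow> (nat \<Rightarrow> real) \<Rightarrow> (real \<Rightarrow> 'a::metric_space) \<Rightarrow> bool"
  where "lips I N \<phi> \<longleftrightarrow> (\<forall>k. (N k)-lipschitz_on (I \<inter> {- real k..0}) \<phi>)"

text \<open>A locally Lipschitz map is Lipschitz on compact sets.\<close>

lemma loc_lipschitz_on_iff_lips:
  assumes I: "history_interval I"
  shows "loc_lipschitz_on I \<phi> \<longleftrightarrow> (\<exists>N. lips I N \<phi>)"
proof
  assume l: "loc_lipschitz_on I \<phi>"
  have "\<exists>L. L-lipschitz_on (I \<inter> {- real k..0}) \<phi>" for k
  proof -
    let ?X = "I \<inter> {- real k..0}"
    have ll: "local_lipschitz {0::real} ?X (\<lambda>_. \<phi>)"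
      unfolding local_lipschitz_def
    proof (intro ballI)
      fix \<theta> t assume \<theta>: "\<theta> \<in> ?X" and "t \<in> {0::real}"
      then obtain u L where "u > 0" "L-lipschitz_on (cball \<theta> u \<inter> I) \<phi>"
        using l unfolding loc_lipschitz_on_def by blast
      then show "\<exists>u>0. \<exists>L. \<forall>t\<in>cball t u \<inter> {0}. L-lipschitz_on (cball \<theta> u \<inter> ?X) \<phi>"
        by (intro exI[of _ u] conjI exI[of _ L]) (auto intro: lipschitz_on_subset)
    qed
    show ?thesis
      by (rule local_lipschitz_compact_implies_lipschitz[OF ll _ compact_sing])
        (use history_intervalD(5)[OF I] in auto)
  qed
  then show "\<exists>N. lips I N \<phi>" unfolding lips_def by metis
next
  assume "\<exists>N. lips I N \<phi>"
  then obtain N where N: "lips I N \<phi>" ..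
  show "loc_lipschitz_on I \<phi>"
    unfolding loc_lipschitz_on_def
  proof
    fix \<theta> assume "\<theta> \<in> I"
    obtain k where k: "\<bar>\<theta>\<bar> + 1 \<le> real k" using real_arch_simple by blast
    have "cball \<theta> 1 \<inter> I \<subseteq> I \<inter> {- real k..0}"
      using k history_intervalD(3)[OF I] by (force simp: dist_real_def)
    then show "\<exists>u>0. \<exists>L. L-lipschitz_on (cball \<theta> u \<inter> I) \<phi>"
      using N by (intro exI[of _ 1] conjI exI[of _ "N k"]) (auto simp: lips_def intro: lipschitz_on_subset)
  qed
qed

section \<open>Continuations of a history\<close>

lemma seg_apply: "\<theta> \<in> I \<Longrightarrow> seg I s u \<theta> = u (s + \<theta>)"
  by (simp add: seg_def)

lemma seg_cong:
  assumes "\<And>\<theta>. \<theta> \<in> I \<Longrightarrow> u (s + \<theta>) = v (r + \<theta>)"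
  shows "seg I s u = seg I r v"
  using assms by (auto simp: seg_def restrict_def)

lemma seg_0_eqI:
  assumes "\<phi> \<in> extensional I" "\<And>\<theta>. \<theta> \<in> I \<Longrightarrow> u \<theta> = \<phi> \<theta>"
  shows "seg I 0 u = \<phi>"
  using assms by (auto simp: seg_def restrict_def extensional_def fun_eq_iff)

text \<open>The continuation of a history is controlled by its values on the closed sets \<open>I\<close> and
  \<open>{0..b}\<close>, which meet in \<open>0\<close>; they are glued there.\<close>

lemma continuous_on_history_Un:
  assumes I: "history_interval I"
    and h: "seg I 0 u \<in> cont_maps I" and u: "continuous_on {0..b} u"
  shows "continuous_on (I \<union> {0..b}) u"
proof -
  have "continuous_on I (seg I 0 u)" using h by (simp add: cont_maps_def)
  then have "continuous_on I u"
    by (rule continuous_on_eq) (simp add: seg_apply)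
  then show ?thesis
    using history_intervalD(1)[OF I] u by (intro continuous_on_closed_Un) auto
qed

text \<open>A segment looks back from \<open>s\<close> either into the old history, and then no deeper than \<open>c\<close>, or
  into the time elapsed since.\<close>

lemma history_shift:
  assumes I: "history_interval I" and "\<theta> \<in> I" "0 \<le> s" "s \<le> b" "-c \<le> \<theta>"
  shows "s + \<theta> \<in> (I \<inter> {-c..0}) \<union> {0..b}"
  using assms history_intervalD(3)[OF I, of \<theta>] history_intervalD(4)[OF I, of \<theta> "s + \<theta>"]
  by (cases "s + \<theta> \<le> 0") auto

lemma seg_in_cont_maps:
  assumes I: "history_interval I"
    and h: "seg I 0 u \<in> cont_maps I" and u: "continuous_on {0..b} u"
    and s: "0 \<le> s" "s \<le> b"
  shows "seg I s u \<in> cont_maps I"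
proof -
  have "(\<lambda>\<theta>. s + \<theta>) ` I \<subseteq> I \<union> {0..b}"
  proof (intro image_subsetI)
    fix \<theta> assume "\<theta> \<in> I"
    then show "s + \<theta> \<in> I \<union> {0..b}"
      using history_shift[OF I _ s, of \<theta> "- \<theta>"] by auto
  qed
  then have "continuous_on I (\<lambda>\<theta>. u (s + \<theta>))"
    by (intro continuous_on_compose2[OF continuous_on_history_Un[OF I h u]] continuous_intros)
  then have "continuous_on I (seg I s u)"
    by (rule continuous_on_eq) (simp add: seg_apply)
  then show ?thesis by (simp add: cont_maps_def seg_def)
qed

text \<open>Up to the accuracy \<open>e\<close>, all segments involve only the values of \<open>u\<close> on the compact set
  \<open>(I \<inter> {- (1 / e)..0}) \<union> {0..b}\<close>, where \<open>u\<close> is uniformly continuous.\<close>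

lemma seg_curve_uniformly_continuous:
  assumes I: "history_interval I"
    and h: "seg I 0 u \<in> cont_maps I" and u: "continuous_on {0..b} u" and e: "0 < e"
  obtains d where "0 < d"
    "\<And>s s'. s \<in> {0..b} \<Longrightarrow> s' \<in> {0..b} \<Longrightarrow> \<bar>s' - s\<bar> < d \<Longrightarrow>
      (t + s', seg I s' u) \<in> nbd I e (t + s, seg I s u)"
proof -
  define K where "K = (I \<inter> {- (1 / e)..0}) \<union> {0..b}"
  have "compact K" unfolding K_def using history_intervalD(5)[OF I] by auto
  moreover have "continuous_on K u"
    using continuous_on_history_Un[OF I h u] by (rule continuous_on_subset) (auto simp: K_def)
  ultimately have "uniformly_continuous_on K u"
    using compact_uniformly_continuous by blast
  then obtain d where d: "0 < d"
    "\<And>x y. x \<in> K \<Longrightarrow> y \<in> K \<Longrightarrow> dist y x < d \<Longrightarrow> dist (u y) (u x) < e"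
    using e unfolding uniformly_continuous_on_def by metis
  show thesis
  proof (rule that[of "min d e"])
    fix s s' assume s: "s \<in> {0..b}" "s' \<in> {0..b}" "\<bar>s' - s\<bar> < min d e"
    have "dist (seg I s' u \<theta>) (seg I s u \<theta>) < e" if "\<theta> \<in> I" "- (1 / e) \<le> \<theta>" for \<theta>
    proof -
      have "s + \<theta> \<in> K" "s' + \<theta> \<in> K"
        using history_shift[OF I that(1) _ _ that(2)] s unfolding K_def by auto
      then show ?thesis using d(2) s that by (simp add: seg_apply dist_real_def)
    qed
    then show "(t + s', seg I s' u) \<in> nbd I e (t + s, seg I s u)"
      using seg_in_cont_maps[OF I h u, of s'] s by (simp add: nbd_def dist_real_def)
  qed (use d e in auto)
qed

text \<open>A solution therefore never leaves the locally Lipschitz histories, and along it the Lipschitz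
  constants are bounded in terms of those of the initial history and of the speed.\<close>

lemma lips_seg:
  assumes I: "history_interval I"
    and N: "lips I N (seg I 0 u)" and B: "B-lipschitz_on {0..b} u"
    and s: "0 \<le> s" "s \<le> b"
  shows "lips I (\<lambda>k. max (N k) B) (seg I s u)"
  unfolding lips_def
proof (intro allI lipschitz_onI)
  fix k :: nat
  have Nk: "(N k)-lipschitz_on (I \<inter> {- real k..0}) (seg I 0 u)"
    using N by (simp add: lips_def)
  let ?m = "max (N k) B"
  show "0 \<le> ?m" using lipschitz_on_nonneg[OF B] by simp
  have mono: "dist (u x) (u y) \<le> ?m * (y - x)"
    if x: "x \<in> (I \<inter> {- real k..0}) \<union> {0..b}" and y: "y \<in> (I \<inter> {- real k..0}) \<union> {0..b}" and "x \<le> y" for x y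
  proof -
    have neg: "dist (u x) (u y) \<le> ?m * (y - x)"
      if "x \<in> I \<inter> {- real k..0}" "y \<in> I \<inter> {- real k..0}" "x \<le> y" for x y
    proof -
      have "dist (u x) (u y) \<le> N k * (y - x)"
        using lipschitz_onD[OF Nk that(1,2)] that by (simp add: seg_apply dist_real_def)
      also have "\<dots> \<le> ?m * (y - x)" using that by (intro mult_right_mono) auto
      finally show ?thesis .
    qed
    have pos: "dist (u x) (u y) \<le> ?m * (y - x)"
      if "x \<in> {0..b}" "y \<in> {0..b}" "x \<le> y" for x y
    proof -
      have "dist (u x) (u y) \<le> B * (y - x)"
        using lipschitz_onD[OF B that(1,2)] that by (simp add: dist_real_def)
      also have "\<dots> \<le> ?m * (y - x)" using that by (intro mult_right_mono) auto
      finally show ?thesis .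
    qed
    consider "y < 0" | "0 \<le> x" | "x \<le> 0" "0 \<le> y" by linarith
    then show ?thesis
    proof cases
      case 1
      then have "x \<in> I \<inter> {- real k..0}" "y \<in> I \<inter> {- real k..0}"
        using x y \<open>x \<le> y\<close> by auto
      then show ?thesis using neg \<open>x \<le> y\<close> by blast
    next
      case 2
      then have "x \<in> {0..b}" "y \<in> {0..b}" using x y \<open>x \<le> y\<close> s by auto
      then show ?thesis using pos \<open>x \<le> y\<close> by blast
    next
      case 3
      have "0 \<in> I \<inter> {- real k..0}" "0 \<in> {0..b}" "x \<in> I \<inter> {- real k..0}" "y \<in> {0..b}"
        using 3 x y s history_intervalD(2)[OF I] by auto
      then have "dist (u x) (u 0) \<le> ?m * (0 - x)" "dist (u 0) (u y) \<le> ?m * (y - 0)"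
        using neg[of x 0] pos[of 0 y] 3 by auto
      then show ?thesis
        using dist_triangle[of "u x" "u y" "u 0"] by (simp add: algebra_simps)
    qed
  qed
  fix x y assume x: "x \<in> I \<inter> {- real k..0}" and y: "y \<in> I \<inter> {- real k..0}"
  then have xs: "s + x \<in> (I \<inter> {- real k..0}) \<union> {0..b}" "s + y \<in> (I \<inter> {- real k..0}) \<union> {0..b}"
    using history_shift[OF I _ s] by auto
  have "dist (u (s + x)) (u (s + y)) \<le> ?m * \<bar>x - y\<bar>"
  proof (cases "x \<le> y")
    case True
    then show ?thesis using mono[OF xs] by simp
  next
    case False
    then show ?thesis using mono[OF xs(2,1)] by (simp add: dist_commute)
  qed
  then show "dist (seg I s u x) (seg I s u y) \<le> ?m * dist x y"
    using x y by (simp add: seg_apply dist_real_def)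
qed

section \<open>Derivatives and primitives\<close>

lemma onorm_scaleR_left_le:
  fixes D :: "'a::real_normed_vector"
  assumes "norm D \<le> B"
  shows "onorm (\<lambda>h::real. h *\<^sub>R D) \<le> B"
proof (rule onorm_bound)
  show "0 \<le> B" using assms norm_ge_zero order_trans by blast
  show "norm (h *\<^sub>R D) \<le> B * norm h" for h
    using mult_right_mono[OF assms, of "\<bar>h\<bar>"] by (simp add: mult.commute)
qed

lemma primitive_lipschitz:
  fixes G :: "real \<Rightarrow> 'b::banach"
  assumes G: "continuous_on {0..b} G" "\<And>s. s \<in> {0..b} \<Longrightarrow> norm (G s) \<le> B"
    and B: "0 \<le> B" and r: "r \<le> r'" "r' \<le> b"
  shows "norm (integral {0..r'} G - integral {0..r} G) \<le> B * (r' - r)"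
proof -
  have bd: "norm (integral {a..c} G) \<le> B * (c - a)" if "0 \<le> a" "a \<le> c" "c \<le> b" for a c
    using that by (intro integral_bound continuous_on_subset[OF G(1)] G(2)) auto
  consider "0 \<le> r" | "r < 0" "0 \<le> r'" | "r < 0" "r' < 0" by linarith
  then show ?thesis
  proof cases
    case 1
    have "integral {0..r} G + integral {r..r'} G = integral {0..r'} G"
      using 1 r by (intro Henstock_Kurzweil_Integration.integral_combine integrable_continuous_real
          continuous_on_subset[OF G(1)]) auto
    then have "integral {0..r'} G - integral {0..r} G = integral {r..r'} G"
      by (simp add: algebra_simps)
    then show ?thesis using bd[of r r'] 1 r by simp
  next
    case 2
    have "norm (integral {0..r'} G) \<le> B * (r' - 0)" using 2 r by (intro bd) auto
    also have "\<dots> \<le> B * (r' - r)" using 2 B by (intro mult_left_mono) auto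
    finally show ?thesis using 2 by simp
  next
    case 3
    then show ?thesis using r B by simp
  qed
qed

lemma has_vector_derivative_Un:
  assumes "(f has_vector_derivative D) (at x within S)" "(f has_vector_derivative D) (at x within T)"
  shows "(f has_vector_derivative D) (at x within (S \<union> T))"
  using assms Lim_Un unfolding has_vector_derivative_def has_derivative_within by blast

lemma has_vector_derivative_trivial:
  assumes "at x within S = bot"
  shows "(f has_vector_derivative D) (at x within S)"
  unfolding has_vector_derivative_def has_derivative_within
  using assms by (simp add: bounded_linear_scaleR_left)

text \<open>Lets a derivative within a set be computed from a part of the set near \<open>x\<close>: on a closed rest
  that avoids \<open>x\<close> every derivative is correct.\<close>

lemma has_vector_derivative_outside:
  assumes "closed S" "x \<notin> S"
  shows "(f has_vector_derivative D) (at x within S)"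
proof (rule has_vector_derivative_trivial)
  show "at x within S = bot"
    using assms by (intro not_in_closure_trivial_limitI) simp
qed

section \<open>The delay equation on an open set of states\<close>

text \<open>The set \<open>Ab\<close> and the map \<open>F\<close> live on continuous histories. Continuity of \<open>F\<close> there allows
  limits of solutions to be taken, while the last assumption gives uniqueness: \<open>F\<close> is
  Lipschitz only along histories that share a prescribed family of Lipschitz constants and that
  differ on a bounded part of \<open>I\<close>; two solutions with a common history are of this kind.\<close>

locale delay_problem =
  fixes I :: "real set"
    and Ab :: "(real \<times> (real \<Rightarrow> 'a::euclidean_space)) set"
    and F :: "real \<times> (real \<Rightarrow> 'a) \<Rightarrow> 'a"
  assumes I: "history_interval I"
    and Ab_cont_maps: "\<And>t \<phi>. (t, \<phi>) \<in> Ab \<Longrightarrow> \<phi> \<in> cont_maps I"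
    and F_cont: "\<And>p \<epsilon>. p \<in> Ab \<Longrightarrow> 0 < \<epsilon> \<Longrightarrow> \<exists>e>0. \<forall>q\<in>nbd I e p. q \<in> Ab \<and> dist (F q) (F p) < \<epsilon>"
    and F_lip: "\<And>p N. p \<in> Ab \<Longrightarrow> (\<And>k. 0 < N k) \<Longrightarrow>
      \<exists>e>0. \<exists>L\<ge>0. \<forall>t \<phi>1 \<phi>2 c. (t, \<phi>1) \<in> nbd I e p \<longrightarrow> (t, \<phi>2) \<in> nbd I e p \<longrightarrow>
        lips I N \<phi>1 \<longrightarrow> lips I N \<phi>2 \<longrightarrow> (\<forall>\<theta>\<in>I. \<theta> < -1 \<longrightarrow> \<phi>1 \<theta> = \<phi>2 \<theta>) \<longrightarrow>
        (\<forall>\<theta>\<in>I. norm (\<phi>1 \<theta> - \<phi>2 \<theta>) \<le> c) \<longrightarrow> norm (F (t, \<phi>1) - F (t, \<phi>2)) \<le> L * c"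
begin

text \<open>The admissible initial states; the topology of uniform convergence on compact sets does not
  see the Lipschitz constants, so nearby states of \<open>A\<close> need not share a family \<open>N\<close>.\<close>

definition A :: "(real \<times> (real \<Rightarrow> 'a)) set"
  where "A = {(t, \<phi>) \<in> Ab. \<exists>N. lips I N \<phi>}"

text \<open>Time is measured from the initial instant \<open>t\<close>; so \<open>u\<close> is defined on \<open>I\<close> and on
  \<open>{0..b}\<close>, whatever the initial instant is.\<close>

definition state :: "real \<Rightarrow> (real \<Rightarrow> 'a) \<Rightarrow> real \<Rightarrow> real \<times> (real \<Rightarrow> 'a)"
  where "state t u s = (t + s, seg I s u)"

definition solves :: "real \<times> (real \<Rightarrow> 'a) \<Rightarrow> real \<Rightarrow> (real \<Rightarrow> 'a) \<Rightarrow> bool"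
  where "solves p b u \<longleftrightarrow> seg I 0 u = snd p \<and>
    (\<forall>s\<in>{0..b}. state (fst p) u s \<in> A \<and>
      (u has_vector_derivative F (state (fst p) u s)) (at s within {0..b}))"

definition lip_ext :: "(real \<Rightarrow> 'a) \<Rightarrow> real \<Rightarrow> real \<Rightarrow> (real \<Rightarrow> 'a) \<Rightarrow> bool"
  where "lip_ext \<phi> B b u \<longleftrightarrow> seg I 0 u = \<phi> \<and> B-lipschitz_on {0..b} u"

text \<open>The quantifier ranges over all Lipschitz continuations, not only over solutions. So the
  property can be used before any solution is known, and the bound on \<open>F\<close> is the same \<open>B\<close> as
  the Lipschitz constant: integrating \<open>F\<close> along a continuation gives a continuation of the same
  kind.\<close>

definition trapped :: "real \<times> (real \<Rightarrow> 'a) \<Rightarrow> real \<Rightarrow> real \<Rightarrow> bool"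
  where "trapped p B b \<longleftrightarrow> (\<forall>u. lip_ext (snd p) B b u \<longrightarrow>
    (\<forall>s\<in>{0..b}. state (fst p) u s \<in> Ab \<and> norm (F (state (fst p) u s)) \<le> B))"

lemma A_subset: "A \<subseteq> Ab" by (auto simp: A_def)

lemma A_cont_maps: "(t, \<phi>) \<in> A \<Longrightarrow> \<phi> \<in> cont_maps I"
  using A_subset Ab_cont_maps by blast

lemma A_lips: "p \<in> A \<Longrightarrow> \<exists>N. lips I N (snd p)"
  by (auto simp: A_def)

lemma zero_in_I: "0 \<in> I" using history_intervalD(2)[OF I] .

lemma lip_ext_0: "lip_ext \<phi> B b u \<Longrightarrow> u 0 = \<phi> 0"
  using zero_in_I seg_apply[of 0 I 0 u] by (simp add: lip_ext_def)

lemma lip_ext_continuous: "lip_ext \<phi> B b u \<Longrightarrow> continuous_on {0..b} u"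
  by (auto simp: lip_ext_def intro: lipschitz_on_continuous_on)

lemma solves_continuous: "solves p b u \<Longrightarrow> continuous_on {0..b} u"
  unfolding solves_def continuous_on_eq_continuous_within
  using has_vector_derivative_continuous by blast

lemma solves_A:
  assumes "solves p b u" "0 \<le> b"
  shows "p \<in> A"
proof -
  have "state (fst p) u 0 \<in> A" using assms by (auto simp: solves_def)
  then show ?thesis using assms(1) by (simp add: solves_def state_def)
qed

lemma solves_cont_maps:
  assumes "solves p b u" "0 \<le> b"
  shows "seg I 0 u \<in> cont_maps I"
  using solves_A[OF assms] A_cont_maps[of "fst p" "snd p"] assms(1) by (auto simp: solves_def)

lemma F_state_continuous:
  assumes h: "seg I 0 u \<in> cont_maps I" and u: "continuous_on {0..b} u"
    and Ab: "\<And>s. s \<in> {0..b} \<Longrightarrow> state t u s \<in> Ab"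
  shows "continuous_on {0..b} (\<lambda>s. F (state t u s))"
  unfolding continuous_on_iff
proof (intro ballI allI impI)
  fix s and \<epsilon> :: real assume s: "s \<in> {0..b}" and \<epsilon>: "0 < \<epsilon>"
  obtain e where e: "0 < e" "\<forall>q\<in>nbd I e (state t u s). q \<in> Ab \<and> dist (F q) (F (state t u s)) < \<epsilon>"
    using F_cont[OF Ab[OF s] \<epsilon>] by blast
  obtain d where d: "0 < d" "\<And>s s'. s \<in> {0..b} \<Longrightarrow> s' \<in> {0..b} \<Longrightarrow> \<bar>s' - s\<bar> < d \<Longrightarrow>
      (t + s', seg I s' u) \<in> nbd I e (t + s, seg I s u)"
    using seg_curve_uniformly_continuous[OF I h u e(1)] by metis
  then show "\<exists>d>0. \<forall>s'\<in>{0..b}. dist s' s < d \<longrightarrow> dist (F (state t u s')) (F (state t u s)) < \<epsilon>"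
    using e(2) s by (intro exI[of _ d]) (auto simp: state_def dist_real_def)
qed

lemma solves_F_continuous:
  assumes "solves p b u" "0 \<le> b"
  shows "continuous_on {0..b} (\<lambda>s. F (state (fst p) u s))"
  using F_state_continuous[OF solves_cont_maps[OF assms] solves_continuous[OF assms(1)]]
    assms(1) A_subset unfolding solves_def by blast

lemma solves_lipschitz:
  assumes "solves p b u" "0 \<le> b" "B \<ge> 0" "\<And>s. s \<in> {0..b} \<Longrightarrow> norm (F (state (fst p) u s)) \<le> B"
  shows "lip_ext (snd p) B b u"
  unfolding lip_ext_def
proof
  show "B-lipschitz_on {0..b} u"
  proof (rule bounded_derivative_imp_lipschitz)
    fix s assume s: "s \<in> {0..b}"
    then show "(u has_derivative (\<lambda>h. h *\<^sub>R F (state (fst p) u s))) (at s within {0..b})"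
      using assms(1) by (simp add: solves_def has_vector_derivative_def)
    show "onorm (\<lambda>h. h *\<^sub>R F (state (fst p) u s)) \<le> B"
      using assms(4)[OF s] by (rule onorm_scaleR_left_le)
  qed (use assms in auto)
  show "seg I 0 u = snd p" using assms(1) by (simp add: solves_def)
qed

text \<open>The derivative of a solution is continuous, hence bounded on a compact interval.\<close>

lemma solves_bound:
  assumes "solves p b u" "0 \<le> b"
  obtains B where "0 \<le> B" "\<And>s. s \<in> {0..b} \<Longrightarrow> norm (F (state (fst p) u s)) \<le> B"
proof -
  have "bounded ((\<lambda>s. F (state (fst p) u s)) ` {0..b})"
    using compact_continuous_image[OF solves_F_continuous[OF assms]] compact_imp_bounded by blast
  then obtain B where "0 < B" "\<forall>x\<in>(\<lambda>s. F (state (fst p) u s)) ` {0..b}. norm x \<le> B"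
    unfolding bounded_pos by blast
  then show thesis by (intro that[of B]) auto
qed

section \<open>Existence by Tonelli approximation\<close>

text \<open>This is where a length of time is found that serves all initial states near \<open>p\<close>. A continuation
  with speed at most \<open>B\<close> moves the state by little in a short time, because the initial history
  is within \<open>e / 3\<close> of the fixed history of \<open>p\<close>, which is uniformly continuous on a compact part
  of \<open>I\<close>.\<close>

lemma trapped_nearby:
  assumes "p \<in> Ab"
  obtains \<delta> d B where "0 < \<delta>" "0 < d" "0 \<le> B" "\<And>q. q \<in> nbd I d p \<Longrightarrow> trapped q B \<delta>"
proof -
  obtain t0 \<phi> where p: "p = (t0, \<phi>)" by (cases p)
  have \<phi>: "\<phi> \<in> cont_maps I" using Ab_cont_maps assms p by blast
  obtain e where e: "0 < e" "\<And>q. q \<in> nbd I e p \<Longrightarrow> q \<in> Ab \<and> dist (F q) (F p) < 1"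
    using F_cont[OF assms zero_less_one] by blast
  \<comment> \<open>The bound for \<open>F\<close> on \<open>nbd I e p\<close>; it also serves as the admitted speed.\<close>
  define B where "B = norm (F p) + 1"
  have "uniformly_continuous_on (I \<inter> {- (1 / e)..0}) \<phi>"
    using \<phi> history_intervalD(5)[OF I]
    by (intro compact_uniformly_continuous) (auto simp: cont_maps_def intro: continuous_on_subset)
  then obtain \<eta> where \<eta>: "0 < \<eta>"
    "\<And>x y. x \<in> I \<inter> {- (1 / e)..0} \<Longrightarrow> y \<in> I \<inter> {- (1 / e)..0} \<Longrightarrow> dist y x < \<eta> \<Longrightarrow> dist (\<phi> y) (\<phi> x) < e / 3"
    using e(1) unfolding uniformly_continuous_on_def by (metis divide_pos_pos zero_less_numeral)
  have B: "0 < B" unfolding B_def using norm_ge_zero[of "F p"] by linarith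
  define \<delta> where "\<delta> = Min {\<eta> / 2, e / (3 * B), e / 3}"
  have \<delta>: "0 < \<delta>" "\<delta> < \<eta>" "\<delta> \<le> e / (3 * B)" "\<delta> \<le> e / 3"
    using \<eta>(1) e(1) B by (auto simp: \<delta>_def min_less_iff_disj)
  have B\<delta>: "B * \<delta> \<le> e / 3" using \<delta>(3) B by (simp add: field_simps)
  have "trapped q B \<delta>" if q: "q \<in> nbd I (e / 3) p" for q
    unfolding trapped_def
  proof (intro allI impI ballI)
    fix u s assume u: "lip_ext (snd q) B \<delta> u" and s: "s \<in> {0..\<delta>}"
    obtain t \<psi> where t: "q = (t, \<psi>)" by (cases q)
    have \<psi>: "seg I 0 u = \<psi>" "\<psi> \<in> cont_maps I" "\<And>\<theta>. \<theta> \<in> I \<Longrightarrow> u \<theta> = \<psi> \<theta>"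
      using u q seg_apply[of _ I 0 u] by (auto simp: lip_ext_def t nbd_def)
    have near: "dist (\<psi> \<theta>) (\<phi> \<theta>) < e / 3" if "\<theta> \<in> I" "- (1 / e) \<le> \<theta>" for \<theta>
    proof -
      have "- (1 / (e / 3)) \<le> - (1 / e)" using e(1) by (simp add: field_simps)
      then show ?thesis using q that unfolding p t nbd_def by force
    qed
    have "dist (u (s + \<theta>)) (\<phi> \<theta>) < e" if \<theta>: "\<theta> \<in> I" "- (1 / e) \<le> \<theta>" for \<theta>
    proof (cases "s + \<theta> \<le> 0")
      case True
      have \<theta>0: "\<theta> \<le> 0" using history_intervalD(3)[OF I \<theta>(1)] .
      have s\<theta>: "s + \<theta> \<in> I" "- (1 / e) \<le> s + \<theta>"
        using history_intervalD(4)[OF I \<theta>(1), of "s + \<theta>"] True s \<theta> by auto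
      have "dist (\<phi> (s + \<theta>)) (\<phi> \<theta>) < e / 3"
        using s s\<theta> \<theta> \<theta>0 True \<delta>(2) by (intro \<eta>(2)) (auto simp: dist_real_def)
      then show ?thesis
        using near[OF s\<theta>] \<psi>(3)[OF s\<theta>(1)] e(1) dist_triangle[of "\<psi> (s + \<theta>)" "\<phi> \<theta>" "\<phi> (s + \<theta>)"]
        by simp
    next
      case False
      have \<theta>0: "\<theta> \<le> 0" using history_intervalD(3)[OF I \<theta>(1)] .
      have "dist (u (s + \<theta>)) (u 0) \<le> B * dist (s + \<theta>) 0"
        using u False s \<theta>0 by (intro lipschitz_onD[of B "{0..\<delta>}"]) (auto simp: lip_ext_def)
      also have "\<dots> \<le> B * \<delta>" using B False s \<theta>0 by (intro mult_left_mono) auto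
      finally have "dist (u (s + \<theta>)) (\<psi> 0) \<le> e / 3"
        using B\<delta> \<psi>(3)[OF zero_in_I] by simp
      moreover have "dist (\<psi> 0) (\<phi> 0) < e / 3" using e(1) by (intro near zero_in_I) auto
      moreover have "dist (\<phi> 0) (\<phi> \<theta>) < e / 3"
        using s \<theta> \<theta>0 zero_in_I False \<delta>(2) e(1) by (intro \<eta>(2)) (auto simp: dist_real_def)
      ultimately show ?thesis
        using dist_triangle[of "u (s + \<theta>)" "\<phi> \<theta>" "\<psi> 0"] dist_triangle[of "\<psi> 0" "\<phi> \<theta>" "\<phi> 0"]
        by linarith
    qed
    moreover have "dist (t + s) t0 < e"
    proof -
      have "\<bar>t - t0\<bar> < e / 3" using q by (simp add: p t nbd_def dist_real_def)
      then show ?thesis using s \<delta>(4) e(1) unfolding dist_real_def atLeastAtMost_iff by linarith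
    qed
    moreover have "seg I s u \<in> cont_maps I"
      using seg_in_cont_maps[OF I _ lip_ext_continuous[OF u], of s] \<psi> s by auto
    ultimately have "state t u s \<in> nbd I e p"
      by (simp add: state_def nbd_def p seg_apply)
    from e(2)[OF this] have "state t u s \<in> Ab" and d: "dist (F (state t u s)) (F p) < 1" by auto
    moreover have "norm (F (state t u s)) \<le> B"
      using d norm_triangle_ineq2[of "F (state t u s)" "F p"] by (simp add: B_def dist_norm)
    ultimately show "state (fst q) u s \<in> Ab \<and> norm (F (state (fst q) u s)) \<le> B"
      by (simp add: t)
  qed
  then show thesis using that[of \<delta> "e / 3" B] \<delta> e B by simp
qed

lemma trapped_F_continuous:
  assumes "trapped p B b" "lip_ext (snd p) B b u" "snd p \<in> cont_maps I"
  shows "continuous_on {0..b} (\<lambda>s. F (state (fst p) u s))"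
proof (rule F_state_continuous)
  show "seg I 0 u \<in> cont_maps I" using assms(2,3) by (simp add: lip_ext_def)
  show "continuous_on {0..b} u" using lip_ext_continuous[OF assms(2)] .
  show "state (fst p) u s \<in> Ab" if "s \<in> {0..b}" for s
    using assms(1,2) that by (auto simp: trapped_def)
qed

text \<open>Delaying the integral by \<open>h\<close> makes the equation explicit: the values on one interval of length
  \<open>h\<close> determine those on the next. Iterating the delayed integral operator from the constant
  continuation thus becomes stationary on \<open>{0..b}\<close> after finitely many steps, and the stationary
  function violates the integral equation by the integral over one such interval only.\<close>

lemma tonelli_approximation:
  assumes \<phi>: "snd p \<in> cont_maps I" and tr: "trapped p B b" and B: "0 \<le> B" and b: "0 \<le> b" and h: "0 < h"
  obtains u where "lip_ext (snd p) B b u"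
    "\<And>s. s \<in> {0..b} \<Longrightarrow>
      norm (u s - snd p 0 - integral {0..s} (\<lambda>r. F (state (fst p) u r))) \<le> B * h"
proof -
  obtain t \<phi>0 where p: "p = (t, \<phi>0)" by (cases p)
  define G where "G u s = F (state t u s)" for u s
  define P where "P u s = (if s \<le> 0 then \<phi>0 s else \<phi>0 0 + integral {0..s - h} (G u))" for u s
  \<comment> \<open>For \<open>s < h\<close> the interval \<open>{0..s - h}\<close> is empty and the integral is \<open>0\<close>.\<close>
  define v where "v m = (P ^^ m) (\<lambda>s. if s \<le> 0 then \<phi>0 s else \<phi>0 0)" for m
  have seg_P: "seg I 0 w = \<phi>0" if "\<And>s. s \<le> 0 \<Longrightarrow> w s = \<phi>0 s" for w
    using \<phi> that history_intervalD(3)[OF I] by (intro seg_0_eqI) (auto simp: p cont_maps_def)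
  have G: "continuous_on {0..b} (G u)" "\<And>s. s \<in> {0..b} \<Longrightarrow> norm (G u s) \<le> B"
    if "lip_ext \<phi>0 B b u" for u
    using trapped_F_continuous[OF tr _ \<phi>, of u] tr that by (auto simp: p G_def trapped_def)
  have P_eq: "P u s = \<phi>0 0 + integral {0..s - h} (G u)" if "0 \<le> s" for u s
    using that h by (auto simp: P_def)
  have P_lip: "lip_ext \<phi>0 B b (P u)" if u: "lip_ext \<phi>0 B b u" for u
    unfolding lip_ext_def
  proof
    show "seg I 0 (P u) = \<phi>0" by (rule seg_P) (simp add: P_def)
    show "B-lipschitz_on {0..b} (P u)"
    proof (rule lipschitz_onI)
      have le: "dist (P u y) (P u x) \<le> B * (y - x)" if "0 \<le> x" "x \<le> y" "y \<le> b" for x y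
        using primitive_lipschitz[OF G[OF u] B, of "x - h" "y - h"] that h
        by (simp add: P_eq dist_norm)
      fix x y assume "x \<in> {0..b}" "y \<in> {0..b}"
      then show "dist (P u x) (P u y) \<le> B * dist x y"
        using le[of x y] le[of y x] by (cases "x \<le> y") (auto simp: dist_real_def dist_commute)
    qed (fact B)
  qed
  have v: "lip_ext \<phi>0 B b (v m)" for m
  proof (induction m)
    case 0
    have "B-lipschitz_on {0..b} (v 0)"
      using B by (intro lipschitz_onI) (auto simp: v_def)
    then show ?case using seg_P[of "v 0"] by (simp add: lip_ext_def v_def)
  next
    case (Suc m)
    then show ?case using P_lip by (simp add: v_def)
  qed
  \<comment> \<open>Because the integral stops at \<open>s - h\<close>, each iteration settles one more step of length \<open>h\<close>.\<close>
  have stable: "v (Suc m) s = v m s" if "s \<le> real (Suc m) * h" "s \<in> {0..b}" for m s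
    using that
  proof (induction m arbitrary: s)
    case 0
    then have "integral {0..s - h} (G (v 0)) = 0"
      by (cases "s = h") auto
    then show ?case using 0 by (simp add: v_def P_def)
  next
    case (Suc m)
    have "integral {0..s - h} (G (v (Suc m))) = integral {0..s - h} (G (v m))"
    proof (rule integral_cong)
      fix r assume r: "r \<in> {0..s - h}"
      have "seg I r (v (Suc m)) = seg I r (v m)"
      proof (rule seg_cong)
        fix \<theta> assume \<theta>: "\<theta> \<in> I"
        have "r \<le> b" using r Suc.prems h by auto
        then have "r + \<theta> \<in> I \<or> r + \<theta> \<in> {0..b}"
          using history_shift[OF I \<theta>, of r b "- \<theta>"] r by auto
        then show "v (Suc m) (r + \<theta>) = v m (r + \<theta>)"
        proof
          assume "r + \<theta> \<in> I"
          then show ?thesis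
            using v[of m] v[of "Suc m"] seg_apply[of "r + \<theta>" I 0] unfolding lip_ext_def
            by (metis add_0)
        next
          assume "r + \<theta> \<in> {0..b}"
          moreover have "r + \<theta> \<le> real (Suc m) * h"
            using r Suc.prems(1) history_intervalD(3)[OF I \<theta>] by (auto simp: algebra_simps)
          ultimately show ?thesis by (intro Suc.IH)
        qed
      qed
      then show "G (v (Suc m)) r = G (v m) r" by (simp add: G_def state_def)
    qed
    moreover have "v (Suc (Suc m)) s = P (v (Suc m)) s" "v (Suc m) s = P (v m) s" by (simp_all add: v_def)
    ultimately show ?case using Suc.prems by (simp add: P_eq)
  qed
  obtain m where m: "b \<le> real m * h" using h reals_Archimedean3 less_imp_le by metis
  then have m': "b \<le> real (Suc m) * h" using h by (simp add: algebra_simps)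
  show thesis
  proof (rule that[of "v m"])
    show "lip_ext (snd p) B b (v m)" using v by (simp add: p)
    fix s assume s: "s \<in> {0..b}"
    have "v m s = P (v m) s" using stable[of s m] m' s by (simp add: v_def)
    then have "norm (v m s - \<phi>0 0 - integral {0..s} (G (v m))) =
        norm (integral {0..s} (G (v m)) - integral {0..s - h} (G (v m)))"
      using s by (simp add: P_eq norm_minus_commute)
    also have "\<dots> \<le> B * h"
      using primitive_lipschitz[OF G[OF v[of m]] B, of "s - h" s] s h by simp
    finally show "norm (v m s - snd p 0 - integral {0..s} (\<lambda>r. F (state (fst p) (v m) r))) \<le> B * h"
      by (simp add: p G_def[abs_def])
  qed
qed

lemma state_near:
  assumes q: "q \<in> nbd I e p" and segs: "seg I 0 y = snd q" "seg I 0 x = snd p"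
    and y: "continuous_on {0..b} y" and close: "\<And>s. s \<in> {0..b} \<Longrightarrow> norm (y s - x s) < e"
    and s: "s \<in> {0..b}"
  shows "state (fst q) y s \<in> nbd I e (state (fst p) x s)"
proof -
  obtain t \<psi> t0 \<phi> where pq: "q = (t, \<psi>)" "p = (t0, \<phi>)" by (cases q, cases p)
  have "dist (y (s + \<theta>)) (x (s + \<theta>)) < e" if \<theta>: "\<theta> \<in> I" "- (1 / e) \<le> \<theta>" for \<theta>
  proof -
    have "s + \<theta> \<in> (I \<inter> {- (1 / e)..0}) \<union> {0..b}"
      using history_shift[OF I \<theta>(1) _ _ \<theta>(2)] s by auto
    then show ?thesis
    proof
      assume *: "s + \<theta> \<in> I \<inter> {- (1 / e)..0}"
      then have "dist (seg I 0 y (s + \<theta>)) (seg I 0 x (s + \<theta>)) < e"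
        using q by (simp add: segs pq nbd_def)
      then show ?thesis using * by (simp add: seg_apply)
    next
      assume "s + \<theta> \<in> {0..b}"
      then show ?thesis using close by (simp add: dist_norm)
    qed
  qed
  moreover have "seg I s y \<in> cont_maps I"
    using seg_in_cont_maps[OF I _ y, of s] s q by (simp add: segs pq nbd_def)
  moreover have "dist (t + s) (t0 + s) < e" using q by (simp add: pq nbd_def)
  ultimately show ?thesis by (simp add: pq state_def nbd_def seg_apply)
qed

text \<open>Both existence and continuous dependence come from this compactness statement. The common speed
  bound \<open>B\<close> makes the approximations equicontinuous, so the Arzela--Ascoli theorem gives a uniform
  limit of a subsequence; by continuity of \<open>F\<close> and dominated convergence the limit satisfies the
  integral equation. The initial histories converge only uniformly on compact sets, and their
  Lipschitz constants may tend to infinity; the limit stays in \<open>A\<close> because it starts at \<open>p\<close>.\<close>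

lemma limit_of_approximations:
  fixes y :: "nat \<Rightarrow> real \<Rightarrow> 'a"
  assumes p: "p \<in> A" and b: "0 \<le> b" and B: "0 \<le> B" and tr: "trapped p B b"
    and q: "\<And>n. q n \<in> nbd I (1 / real (Suc n)) p" and trq: "\<And>n. trapped (q n) B b"
    and y: "\<And>n. lip_ext (snd (q n)) B b (y n)"
    and approx: "\<And>n s. s \<in> {0..b} \<Longrightarrow>
      norm (y n s - snd (q n) 0 - integral {0..s} (\<lambda>r. F (state (fst (q n)) (y n) r))) \<le> \<eta> n"
    and \<eta>: "\<eta> \<longlonglongrightarrow> 0"
  obtains x k where "strict_mono (k :: nat \<Rightarrow> nat)" "solves p b x" "lip_ext (snd p) B b x"
    "\<And>e. 0 < e \<Longrightarrow> \<exists>N. \<forall>n\<ge>N. \<forall>s\<in>{0..b}. norm (y (k n) s - x s) < e"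
proof -
  obtain t \<phi> where p_eq: "p = (t, \<phi>)" by (cases p)
  have \<phi>: "\<phi> \<in> cont_maps I" using A_cont_maps p p_eq by blast
  have qc: "snd (q n) \<in> cont_maps I" for n using q[of n] by (auto simp: nbd_def)
  have y0: "y n 0 = snd (q n) 0" for n using lip_ext_0[OF y] .
  have y0\<phi>: "dist (y n 0) (\<phi> 0) < 1 / real (Suc n)" for n
    using q[of n] zero_in_I by (auto simp: y0 nbd_def p_eq)
  have lip: "B-lipschitz_on {0..b} (y n)" for n using y by (simp add: lip_ext_def)
  obtain g k where g: "continuous_on {0..b} g" and k: "strict_mono (k :: nat \<Rightarrow> nat)"
    and lim: "\<And>e. 0 < e \<Longrightarrow> \<exists>N. \<forall>n s. n \<ge> N \<and> s \<in> {0..b} \<longrightarrow> norm (y (k n) s - g s) < e"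
  proof (rule Arzela_Ascoli[of "{0..b}" y "norm (\<phi> 0) + 1 + B * b"])
    fix n s assume s: "s \<in> {0..b}"
    have "dist (y n s) (y n 0) \<le> B * dist s 0" using s b by (intro lipschitz_onD[OF lip]) auto
    also have "\<dots> \<le> B * b" using s B by (intro mult_left_mono) auto
    finally have "norm (y n s - y n 0) \<le> B * b" by (simp add: dist_norm)
    moreover have "norm (y n 0 - \<phi> 0) \<le> 1"
    proof -
      have "1 / real (Suc n) \<le> 1" by simp
      then show ?thesis using y0\<phi>[of n] unfolding dist_norm by linarith
    qed
    ultimately show "norm (y n s) \<le> norm (\<phi> 0) + 1 + B * b"
      using norm_triangle_sub[of "y n s" "y n 0"] norm_triangle_sub[of "y n 0" "\<phi> 0"] by linarith
  next
    fix s e :: real assume s: "s \<in> {0..b}" and e: "0 < e"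
    have "norm (y n s - y n r) < e" if r: "r \<in> {0..b}" "norm (s - r) < e / (B + 1)" for n r
    proof -
      have "norm (y n s - y n r) \<le> B * norm (s - r)"
        using lipschitz_onD[OF lip s r(1), of n] by (simp add: dist_norm)
      also have "\<dots> \<le> (B + 1) * norm (s - r)" by (intro mult_right_mono) auto
      also have "\<dots> < e" using r(2) B by (simp add: field_simps)
      finally show ?thesis .
    qed
    then show "\<exists>d>0. \<forall>n r. r \<in> {0..b} \<and> norm (s - r) < d \<longrightarrow> norm (y n s - y n r) < e"
      using e B by (intro exI[of _ "e / (B + 1)"]) auto
  qed (auto)
  have lims: "(\<lambda>n. y (k n) s) \<longlonglongrightarrow> g s" if "s \<in> {0..b}" for s
    unfolding LIMSEQ_iff using lim that by meson
  have "(\<lambda>n. y (k n) 0) \<longlonglongrightarrow> \<phi> 0"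
  proof -
    have "(\<lambda>n. dist (y n 0) (\<phi> 0)) \<longlonglongrightarrow> 0"
      using less_imp_le[OF y0\<phi>]
      by (intro tendsto_sandwich[OF _ _ tendsto_const LIMSEQ_Suc[OF lim_1_over_n]]) auto
    then have "(\<lambda>n. y n 0) \<longlonglongrightarrow> \<phi> 0" by (rule tendsto_dist_iff[THEN iffD2])
    from LIMSEQ_subseq_LIMSEQ[OF this k] show ?thesis by (simp add: o_def)
  qed
  with lims[of 0] b have g0: "g 0 = \<phi> 0" using LIMSEQ_unique by fastforce
  define x where "x s = (if s \<le> 0 then \<phi> s else g s)" for s
  have xg: "x s = g s" if "0 \<le> s" for s using that g0 by (auto simp: x_def)
  have segx: "seg I 0 x = \<phi>"
    using \<phi> history_intervalD(3)[OF I] by (intro seg_0_eqI) (auto simp: x_def cont_maps_def)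
  have limx: "\<exists>N. \<forall>n\<ge>N. \<forall>s\<in>{0..b}. norm (y (k n) s - x s) < e" if "0 < e" for e
    using lim[OF that] xg by (metis atLeastAtMost_iff)
  have x_lip: "lip_ext \<phi> B b x"
    unfolding lip_ext_def
  proof
    show "B-lipschitz_on {0..b} x"
    proof (rule lipschitz_onI)
      fix r s assume r: "r \<in> {0..b}" "s \<in> {0..b}"
      have "(\<lambda>n. dist (y (k n) r) (y (k n) s)) \<longlonglongrightarrow> dist (g r) (g s)"
        using lims r by (intro tendsto_intros)
      then have "dist (g r) (g s) \<le> B * dist r s"
        using lipschitz_onD[OF lip r] by (intro LIMSEQ_le_const2) auto
      then show "dist (x r) (x s) \<le> B * dist r s" using r xg by simp
    qed (fact B)
  qed (fact segx)
  have xAb: "state t x s \<in> Ab" "norm (F (state t x s)) \<le> B" if "s \<in> {0..b}" for s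
    using tr x_lip that by (auto simp: trapped_def p_eq)
  have xA: "state t x s \<in> A" if s: "s \<in> {0..b}" for s
  proof -
    obtain N where "lips I N (seg I 0 x)" using A_lips[OF p] segx p_eq by auto
    then have "lips I (\<lambda>k. max (N k) B) (seg I s x)"
      using lips_seg[OF I _ _, of N x B b s] x_lip s by (auto simp: lip_ext_def)
    then show ?thesis using xAb(1)[OF s] by (auto simp: A_def state_def)
  qed
  have cont: "continuous_on {0..b} (\<lambda>s. F (state t x s))"
    using trapped_F_continuous[OF tr, of x] x_lip \<phi> by (simp add: p_eq)
  have contn: "continuous_on {0..b} (\<lambda>r. F (state (fst (q n)) (y n) r))" for n
    using trapped_F_continuous[OF trq y qc] .
  have F_lim: "(\<lambda>n. F (state (fst (q (k n))) (y (k n)) s)) \<longlonglongrightarrow> F (state t x s)"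
    if s: "s \<in> {0..b}" for s
    unfolding lim_sequentially
  proof (intro allI impI)
    fix \<epsilon> :: real assume "0 < \<epsilon>"
    then obtain e where e: "0 < e" "\<And>q. q \<in> nbd I e (state t x s) \<Longrightarrow> dist (F q) (F (state t x s)) < \<epsilon>"
      using F_cont[OF xAb(1)[OF s]] by blast
    obtain N where N: "\<forall>n\<ge>N. \<forall>s\<in>{0..b}. norm (y (k n) s - x s) < e" using limx[OF e(1)] by blast
    obtain M :: nat where M: "1 / e \<le> real M" using real_arch_simple by blast
    have "dist (F (state (fst (q (k n))) (y (k n)) s)) (F (state t x s)) < \<epsilon>" if n: "n \<ge> max N M" for n
    proof (rule e(2))
      have "1 / e \<le> real (Suc (k n))" using M n strict_mono_imp_increasing[OF k, of n] by linarith
      then have "1 / real (Suc (k n)) \<le> e"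
        using e(1) by (simp add: field_simps)
      then have "q (k n) \<in> nbd I e p" using q[of "k n"] nbd_mono[of "1 / real (Suc (k n))" e I p] by auto
      then show "state (fst (q (k n))) (y (k n)) s \<in> nbd I e (state t x s)"
        using state_near[of "q (k n)" e p "y (k n)" x b s] N n s segx y[of "k n"]
          lip_ext_continuous[OF y[of "k n"]]
        by (simp add: lip_ext_def p_eq)
    qed
    then show "\<exists>no. \<forall>n\<ge>no. dist (F (state (fst (q (k n))) (y (k n)) s)) (F (state t x s)) < \<epsilon>" by blast
  qed
  have x_int: "x s = \<phi> 0 + integral {0..s} (\<lambda>r. F (state t x r))" if s: "s \<in> {0..b}" for s
  proof -
    have sub: "{0..s} \<subseteq> {0..b}" using s by auto
    have int: "(\<lambda>n. integral {0..s} (\<lambda>r. F (state (fst (q (k n))) (y (k n)) r)))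
        \<longlonglongrightarrow> integral {0..s} (\<lambda>r. F (state t x r))"
    proof (rule dominated_convergence(2)[where h = "\<lambda>_. B"])
      show "(\<lambda>r. F (state (fst (q (k n))) (y (k n)) r)) integrable_on {0..s}" for n
        by (intro integrable_continuous_real continuous_on_subset[OF contn sub])
      show "norm (F (state (fst (q (k n))) (y (k n)) r)) \<le> B" if "r \<in> {0..s}" for n r
        using trq[of "k n"] y[of "k n"] that sub by (auto simp: trapped_def)
    qed (use F_lim sub in \<open>auto intro: integrable_const_ivl\<close>)
    have "(\<lambda>n. y (k n) s - y (k n) 0 - integral {0..s} (\<lambda>r. F (state (fst (q (k n))) (y (k n)) r)))
        \<longlonglongrightarrow> g s - g 0 - integral {0..s} (\<lambda>r. F (state t x r))"
      using lims[of s] lims[of 0] s b int by (intro tendsto_diff) auto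
    moreover have "(\<lambda>n. y (k n) s - y (k n) 0 - integral {0..s} (\<lambda>r. F (state (fst (q (k n))) (y (k n)) r)))
        \<longlonglongrightarrow> 0"
    proof (rule Lim_null_comparison)
      show "\<forall>\<^sub>F n in sequentially. norm (y (k n) s - y (k n) 0 -
          integral {0..s} (\<lambda>r. F (state (fst (q (k n))) (y (k n)) r))) \<le> \<eta> (k n)"
        using approx[OF s] by (simp add: y0)
      show "(\<lambda>n. \<eta> (k n)) \<longlonglongrightarrow> 0" using LIMSEQ_subseq_LIMSEQ[OF \<eta> k] by (simp add: o_def)
    qed
    ultimately have "g s - g 0 - integral {0..s} (\<lambda>r. F (state t x r)) = 0"
      using LIMSEQ_unique by blast
    then show ?thesis using s xg g0 by (simp add: algebra_simps)
  qed
  have sol: "solves p b x"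
    unfolding solves_def p_eq
  proof (intro conjI ballI)
    fix s assume s: "s \<in> {0..b}"
    have "((\<lambda>s. \<phi> 0 + integral {0..s} (\<lambda>r. F (state t x r))) has_vector_derivative 0 + F (state t x s))
        (at s within {0..b})"
      by (intro has_vector_derivative_add has_vector_derivative_const
          integral_has_vector_derivative[OF cont s])
    then have "((\<lambda>s. \<phi> 0 + integral {0..s} (\<lambda>r. F (state t x r))) has_vector_derivative F (state t x s))
        (at s within {0..b})"
      by (simp only: add_0)
    from has_vector_derivative_transform[OF s x_int this]
    show "(x has_vector_derivative F (state (fst (t, \<phi>)) x s)) (at s within {0..b})"
      by simp
  qed (use xA segx in auto)
  show thesis
  proof (rule that[OF k sol])
    show "lip_ext (snd p) B b x" using x_lip by (simp add: p_eq)
  qed (fact limx)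
qed

lemma exists_solution_trapped:
  assumes p: "p \<in> A" and b: "0 \<le> b" and B: "0 \<le> B" and tr: "trapped p B b"
  obtains u where "solves p b u" "lip_ext (snd p) B b u"
proof -
  have \<phi>: "snd p \<in> cont_maps I" using A_cont_maps[of "fst p" "snd p"] p by simp
  have "\<forall>n. \<exists>u. lip_ext (snd p) B b u \<and> (\<forall>s\<in>{0..b}.
      norm (u s - snd p 0 - integral {0..s} (\<lambda>r. F (state (fst p) u r))) \<le> B * (1 / real (Suc n)))"
    using tonelli_approximation[OF \<phi> tr B b] by (metis of_nat_0_less_iff zero_less_Suc zero_less_divide_1_iff)
  then obtain y where y: "\<And>n. lip_ext (snd p) B b (y n)"
    "\<And>n s. s \<in> {0..b} \<Longrightarrow> norm (y n s - snd p 0 - integral {0..s} (\<lambda>r. F (state (fst p) (y n) r)))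
      \<le> B * (1 / real (Suc n))"
    by metis
  have near: "p \<in> nbd I (1 / real (Suc n)) p" for n
    using nbd_self[of "1 / real (Suc n)" "snd p" I "fst p"] \<phi> by simp
  have lim: "(\<lambda>n. B * (1 / real (Suc n))) \<longlonglongrightarrow> 0"
    using tendsto_mult_right_zero[OF LIMSEQ_Suc[OF lim_1_over_n]] by blast
  show thesis
    by (rule limit_of_approximations[OF p b B tr near tr y lim]) (assumption, rule that)
qed

section \<open>Uniqueness\<close>

lemma solves_history:
  assumes "solves p b u" "solves p b' v" "\<theta> \<in> I"
  shows "u \<theta> = v \<theta>"
  using assms seg_apply[OF assms(3), of 0 u] seg_apply[OF assms(3), of 0 v] by (simp add: solves_def)

lemma state_cong:
  assumes "\<And>\<theta>. \<theta> \<in> I \<Longrightarrow> u \<theta> = v \<theta>" "\<And>r. r \<in> {0..b} \<Longrightarrow> u r = v r" "s \<in> {0..b}"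
  shows "state t u s = state t v s"
proof -
  have "seg I s u = seg I s v"
  proof (rule seg_cong)
    fix \<theta> assume "\<theta> \<in> I"
    then show "u (s + \<theta>) = v (s + \<theta>)"
      using history_shift[OF I, of \<theta> s b "- \<theta>"] assms by auto
  qed
  then show ?thesis by (simp add: state_def)
qed

lemma state_shift: "state (t + s) (\<lambda>r. u (s + r)) r = state t u (s + r)"
  using seg_cong[of I "\<lambda>r. u (s + r)" r u "s + r"] by (simp add: state_def add.assoc)

lemma solves_restrict:
  assumes "solves p b u" "b' \<le> b"
  shows "solves p b' u"
  unfolding solves_def
proof (intro conjI ballI)
  fix s assume s: "s \<in> {0..b'}"
  then show "state (fst p) u s \<in> A" using assms by (auto simp: solves_def)
  have "(u has_vector_derivative F (state (fst p) u s)) (at s within {0..b})"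
    using assms s by (auto simp: solves_def)
  then show "(u has_vector_derivative F (state (fst p) u s)) (at s within {0..b'})"
    by (rule has_vector_derivative_within_subset) (use assms(2) in auto)
qed (use assms in \<open>simp add: solves_def\<close>)

lemma solves_restart:
  assumes u: "solves p b u" and s: "0 \<le> s" "s \<le> b"
  shows "solves (state (fst p) u s) (b - s) (\<lambda>r. u (s + r))"
  unfolding solves_def
proof (intro conjI ballI)
  show "seg I 0 (\<lambda>r. u (s + r)) = snd (state (fst p) u s)"
    by (auto simp: state_def intro: seg_cong)
  fix r assume r: "r \<in> {0..b - s}"
  have eq: "state (fst (state (fst p) u s)) (\<lambda>r. u (s + r)) r = state (fst p) u (s + r)"
    using state_shift[of "fst p" s u r] by (simp add: state_def)
  show "state (fst (state (fst p) u s)) (\<lambda>r. u (s + r)) r \<in> A"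
    unfolding eq using u r s by (auto simp: solves_def)
  have "(u has_vector_derivative F (state (fst p) u (s + r))) (at (s + r) within {0..b})"
    using u r s by (auto simp: solves_def)
  then have "(u has_vector_derivative F (state (fst p) u (s + r))) (at (s + r) within (+) s ` {0..b - s})"
    using s by (elim has_vector_derivative_within_subset) auto
  from vector_diff_chain_within[OF _ this, of 1] show
    "((\<lambda>r. u (s + r)) has_vector_derivative F (state (fst (state (fst p) u s)) (\<lambda>r. u (s + r)) r))
      (at r within {0..b - s})"
    unfolding eq by (simp add: o_def has_vector_derivative_add_const has_vector_derivative_id
        has_vector_derivative_add[OF has_vector_derivative_const has_vector_derivative_id, simplified])
qed

text \<open>Two solutions from the same state have equal histories, so on a short interval their segments
  differ only on \<open>{-1..0}\<close>, and they share the Lipschitz constants \<open>N'\<close>: this is the situation in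
  which \<open>F\<close> is Lipschitz. If \<open>c\<close> is the largest distance of the two solutions on \<open>{0..d}\<close>, then
  their derivatives differ by at most \<open>L * c\<close>, whence \<open>c \<le> L * c * d \<le> c / 2\<close>.\<close>

lemma local_uniqueness:
  assumes u: "solves p b u" and v: "solves p b v" and b: "0 < b"
  obtains d where "0 < d" "d \<le> b" "\<And>s. s \<in> {0..d} \<Longrightarrow> u s = v s"
proof -
  have b0: "0 \<le> b" using b by simp
  obtain t \<phi> where p: "p = (t, \<phi>)" by (cases p)
  have pA: "p \<in> A" by (rule solves_A[OF u b0])
  have segs: "seg I 0 u = \<phi>" "seg I 0 v = \<phi>" using u v by (simp_all add: solves_def p)
  obtain B1 where B1: "0 \<le> B1" "\<And>s. s \<in> {0..b} \<Longrightarrow> norm (F (state (fst p) u s)) \<le> B1"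
    using solves_bound[OF u b0] by metis
  obtain B2 where B2: "0 \<le> B2" "\<And>s. s \<in> {0..b} \<Longrightarrow> norm (F (state (fst p) v s)) \<le> B2"
    using solves_bound[OF v b0] by metis
  define B where "B = max B1 B2"
  have B: "0 \<le> B" using B1 by (simp add: B_def)
  have lip: "lip_ext \<phi> B b u" "lip_ext \<phi> B b v"
    using solves_lipschitz[OF u b0 B] solves_lipschitz[OF v b0 B] B1(2) B2(2)
    by (force simp: B_def p)+
  obtain N where N: "lips I N \<phi>" using A_lips[OF pA] by (auto simp: p)
  \<comment> \<open>The summand \<open>1\<close> makes the constants positive.\<close>
  define N' where "N' k = max (N k) B + 1" for k
  have N'pos: "0 < N' k" for k using B by (auto simp: N'_def)
  have lips': "lips I N' (seg I s w)" if "lip_ext \<phi> B b w" "s \<in> {0..b}" for w s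
  proof -
    have "lips I (\<lambda>k. max (N k) B) (seg I s w)"
      using lips_seg[OF I _ _, of N w B b s] N that by (auto simp: lip_ext_def)
    then show ?thesis by (auto simp: lips_def N'_def intro: lipschitz_on_le)
  qed
  obtain e L where e: "0 < e" and L: "0 \<le> L" and Lip: "\<And>t \<phi>1 \<phi>2 c. (t, \<phi>1) \<in> nbd I e p \<Longrightarrow>
      (t, \<phi>2) \<in> nbd I e p \<Longrightarrow> lips I N' \<phi>1 \<Longrightarrow> lips I N' \<phi>2 \<Longrightarrow> (\<forall>\<theta>\<in>I. \<theta> < -1 \<longrightarrow> \<phi>1 \<theta> = \<phi>2 \<theta>) \<Longrightarrow>
      (\<forall>\<theta>\<in>I. norm (\<phi>1 \<theta> - \<phi>2 \<theta>) \<le> c) \<Longrightarrow> norm (F (t, \<phi>1) - F (t, \<phi>2)) \<le> L * c"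
    using F_lip[of p N'] N'pos pA A_subset by blast
  have cont: "continuous_on {0..b} u" "continuous_on {0..b} v"
    using solves_continuous u v by blast+
  have \<phi>: "\<phi> \<in> cont_maps I" using A_cont_maps pA p by blast
  obtain d1 where d1: "0 < d1" "\<And>s. s \<in> {0..b} \<Longrightarrow> \<bar>s\<bar> < d1 \<Longrightarrow> (t + s, seg I s u) \<in> nbd I e p"
    using seg_curve_uniformly_continuous[OF I _ cont(1) e, of t] segs(1) \<phi> b0
    unfolding p by (metis add_0_right atLeastAtMost_iff diff_zero order_refl)
  obtain d2 where d2: "0 < d2" "\<And>s. s \<in> {0..b} \<Longrightarrow> \<bar>s\<bar> < d2 \<Longrightarrow> (t + s, seg I s v) \<in> nbd I e p"
    using seg_curve_uniformly_continuous[OF I _ cont(2) e, of t] segs(2) \<phi> b0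
    unfolding p by (metis add_0_right atLeastAtMost_iff diff_zero order_refl)
  define d where "d = Min {b, d1 / 2, d2 / 2, 1, 1 / (2 * (L + 1))}"
  have d: "0 < d" "d \<le> b" "d < d1" "d < d2" "d \<le> 1" "d \<le> 1 / (2 * (L + 1))"
    using b d1(1) d2(1) L by (auto simp: d_def min_less_iff_disj min_le_iff_disj)
  have "continuous_on {0..d} (\<lambda>s. norm (u s - v s))"
    using d cont by (intro continuous_intros continuous_on_subset[OF cont(1)] continuous_on_subset[OF cont(2)]) auto
  then obtain m where m: "m \<in> {0..d}" "\<And>s. s \<in> {0..d} \<Longrightarrow> norm (u s - v s) \<le> norm (u m - v m)"
    using continuous_attains_sup[of "{0..d}" "\<lambda>s. norm (u s - v s)"] d by auto
  define c where "c = norm (u m - v m)"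
  have Fd: "norm (F (state t u s) - F (state t v s)) \<le> L * c" if s: "s \<in> {0..d}" for s
    unfolding state_def
  proof (rule Lip)
    have uv: "u \<theta> = v \<theta>" if "\<theta> \<in> I" for \<theta> using solves_history[OF u v that] .
    have sb: "s \<in> {0..b}" "\<bar>s\<bar> < d1" "\<bar>s\<bar> < d2" using s d by auto
    show "(t + s, seg I s u) \<in> nbd I e p" "(t + s, seg I s v) \<in> nbd I e p"
      using d1(2) d2(2) sb by blast+
    show "lips I N' (seg I s u)" "lips I N' (seg I s v)"
      using lips' lip sb by blast+
    show "\<forall>\<theta>\<in>I. \<theta> < - 1 \<longrightarrow> seg I s u \<theta> = seg I s v \<theta>"
    proof (intro ballI impI)
      fix \<theta> assume "\<theta> \<in> I" "\<theta> < - 1"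
      then have "s + \<theta> \<in> I" using history_intervalD(4)[OF I, of \<theta> "s + \<theta>"] s d by auto
      then show "seg I s u \<theta> = seg I s v \<theta>" using uv \<open>\<theta> \<in> I\<close> by (simp add: seg_apply)
    qed
    show "\<forall>\<theta>\<in>I. norm (seg I s u \<theta> - seg I s v \<theta>) \<le> c"
    proof
      fix \<theta> assume \<theta>: "\<theta> \<in> I"
      then have "s + \<theta> \<in> I \<or> s + \<theta> \<in> {0..d}"
        using history_shift[OF I \<theta>, of s d "- \<theta>"] s by auto
      then show "norm (seg I s u \<theta> - seg I s v \<theta>) \<le> c"
        using uv m(2) \<theta> by (auto simp: seg_apply c_def)
    qed
  qed
  have "(L * c)-lipschitz_on {0..d} (\<lambda>s. u s - v s)"
  proof (rule bounded_derivative_imp_lipschitz)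
    fix s assume s: "s \<in> {0..d}"
    have "((\<lambda>s. u s - v s) has_vector_derivative F (state t u s) - F (state t v s)) (at s within {0..d})"
      using solves_restrict[OF u d(2)] solves_restrict[OF v d(2)] s
      by (intro has_vector_derivative_diff) (auto simp: solves_def p)
    then show "((\<lambda>s. u s - v s) has_derivative (\<lambda>h. h *\<^sub>R (F (state t u s) - F (state t v s))))
        (at s within {0..d})"
      by (simp add: has_vector_derivative_def)
    show "onorm (\<lambda>h. h *\<^sub>R (F (state t u s) - F (state t v s))) \<le> L * c"
      using Fd[OF s] by (rule onorm_scaleR_left_le)
  qed (use L in \<open>auto simp: c_def\<close>)
  from lipschitz_onD[OF this m(1), of 0] have "norm (u m - v m - (u 0 - v 0)) \<le> L * c * m"
    using d m by (auto simp: dist_norm)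
  moreover have "u 0 = v 0" using solves_history[OF u v zero_in_I] .
  ultimately have "c \<le> c * (L * m)" by (simp add: c_def mult.commute mult.left_commute)
  also have "\<dots> \<le> c * (1 / 2)"
  proof (rule mult_left_mono)
    have "L * m \<le> (L + 1) * (1 / (2 * (L + 1)))"
      using m(1) d L by (intro mult_mono) auto
    also have "\<dots> = 1 / 2" using L by (simp add: field_simps)
    finally show "L * m \<le> 1 / 2" .
  qed (simp add: c_def)
  finally have "c \<le> 0" by simp
  then have "u s = v s" if "s \<in> {0..d}" for s
    using m(2)[OF that] unfolding c_def[symmetric] by (smt (verit) norm_le_zero_iff right_minus_eq)
  with d show thesis by (intro that)
qed

text \<open>If two solutions differ, they agree up to the infimum \<open>\<sigma>\<close> of the times where they differ.
  Restarting both at \<open>\<sigma>\<close>, local uniqueness lets them agree for a while longer.\<close>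

lemma solves_unique:
  assumes u: "solves p b u" and v: "solves p b v" and s: "s \<in> {0..b}"
  shows "u s = v s"
proof (rule ccontr)
  assume ne: "u s \<noteq> v s"
  define Z where "Z = {r \<in> {0..b}. u r \<noteq> v r}"
  have Z: "s \<in> Z" "bdd_below Z" "\<And>r. r \<in> Z \<Longrightarrow> 0 \<le> r"
    using s ne by (auto simp: Z_def intro: bdd_belowI[of _ 0])
  define \<sigma> where "\<sigma> = Inf Z"
  have \<sigma>: "0 \<le> \<sigma>" "\<sigma> \<le> s"
    unfolding \<sigma>_def using Z by (auto intro: cInf_greatest cInf_lower)
  have before: "u r = v r" if "0 \<le> r" "r < \<sigma>" for r
    using cInf_lower[OF _ Z(2), of r] that \<sigma> s unfolding \<sigma>_def[symmetric] by (fastforce simp: Z_def)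
  have at: "u r = v r" if "r \<in> {0..\<sigma>}" for r
  proof (cases "\<sigma> = 0")
    case True
    then show ?thesis using that solves_history[OF u v zero_in_I] by simp
  next
    case False
    have "closed {r \<in> {0..b}. u r - v r = 0}"
      using solves_continuous[OF u] solves_continuous[OF v]
      by (intro continuous_closed_preimage_constant continuous_intros) auto
    moreover have "{0..<\<sigma>} \<subseteq> {r \<in> {0..b}. u r - v r = 0}"
      using before \<sigma> s by auto
    ultimately have "closure {0..<\<sigma>} \<subseteq> {r \<in> {0..b}. u r - v r = 0}" by (rule closure_minimal[rotated])
    then show ?thesis using that \<sigma> False by auto
  qed
  have \<sigma>s: "\<sigma> < s" using at[of s] ne \<sigma> s by (cases "\<sigma> = s") auto
  then have \<sigma>b: "\<sigma> \<le> b" "0 < b - \<sigma>" using s by auto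
  have "state (fst p) u \<sigma> = state (fst p) v \<sigma>"
    by (rule state_cong[of _ _ \<sigma>]) (use at \<sigma> solves_history[OF u v] in auto)
  then obtain d where d: "0 < d" "\<And>r. r \<in> {0..d} \<Longrightarrow> u (\<sigma> + r) = v (\<sigma> + r)"
    using local_uniqueness[OF solves_restart[OF u \<sigma>(1) \<sigma>b(1)] _ \<sigma>b(2), of "\<lambda>r. v (\<sigma> + r)"]
      solves_restart[OF v \<sigma>(1) \<sigma>b(1)] by auto
  have "\<sigma> + d \<le> Inf Z"
  proof (rule cInf_greatest)
    fix r assume r: "r \<in> Z"
    then have "\<sigma> \<le> r" unfolding \<sigma>_def using Z by (intro cInf_lower)
    then show "\<sigma> + d \<le> r" using d(2)[of "r - \<sigma>"] r by (force simp: Z_def)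
  qed (use Z in auto)
  then show False using d(1) by (simp add: \<sigma>_def)
qed

section \<open>Continuation and dependence on the initial state\<close>

lemma solves_concat:
  assumes u: "solves p b u" and v: "solves (state (fst p) u b) c v" and b: "0 \<le> b" and c: "0 \<le> c"
  obtains w where "solves p (b + c) w" "\<forall>s\<le>b. state (fst p) w s = state (fst p) u s"
    "\<forall>r\<in>{0..c}. state (fst p) w (b + r) = state (fst p + b) v r"
proof -
  obtain t \<phi> where p: "p = (t, \<phi>)" by (cases p)
  define w where "w r = (if r \<le> b then u r else v (r - b))" for r
  have fb: "fst (state t u b) = t + b" by (simp add: state_def)
  have uv: "u (b + \<theta>) = v \<theta>" if "\<theta> \<in> I" for \<theta>
    using v seg_apply[OF that, of b u] seg_apply[OF that, of 0 v] by (simp add: solves_def state_def)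
  have wI: "w (b + r) = v r" if "r \<in> I" for r
    using uv[OF that] history_intervalD(3)[OF I that] by (simp add: w_def)
  have w0: "w (b + r) = v r" if "0 \<le> r" for r
    using that uv[OF zero_in_I] by (auto simp: w_def)
  have sw: "state t w s = state t u s" if s: "s \<le> b" for s
  proof -
    have "seg I s w = seg I s u"
      using s history_intervalD(3)[OF I] by (intro seg_cong) (force simp: w_def)
    then show ?thesis by (simp add: state_def)
  qed
  have swv: "state t w (b + r) = state (t + b) v r" if r: "r \<in> {0..c}" for r
  proof -
    have "state t w (b + r) = state (t + b) (\<lambda>r. w (b + r)) r" by (simp only: state_shift)
    also have "\<dots> = state (t + b) v r" using r wI w0 by (intro state_cong[of _ _ c]) auto
    finally show ?thesis .
  qed
  have "solves p (b + c) w"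
    unfolding solves_def p fst_conv snd_conv
  proof (intro conjI ballI)
    show "seg I 0 w = \<phi>"
      using sw[OF b] u by (simp add: state_def solves_def p)
    fix s assume s: "s \<in> {0..b + c}"
    show "state t w s \<in> A"
    proof (cases "s \<le> b")
      case True
      then show ?thesis using sw u s by (auto simp: solves_def p)
    next
      case False
      then have r: "s - b \<in> {0..c}" using s by auto
      then have "state (t + b) v (s - b) \<in> A" using v by (simp add: solves_def p fb)
      then show ?thesis using swv[OF r] by simp
    qed
    have 1: "(w has_vector_derivative F (state t w s)) (at s within {0..b})"
    proof (cases "s \<le> b")
      case True
      then have sb: "s \<in> {0..b}" using s by simp
      then have "(u has_vector_derivative F (state t w s)) (at s within {0..b})"
        using u True by (simp add: solves_def p sw)
      then show ?thesis
        by (rule has_vector_derivative_transform[OF sb, rotated]) (simp add: w_def)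
    qed (simp add: has_vector_derivative_outside)
    have 2: "(w has_vector_derivative F (state t w s)) (at s within {b..b + c})"
    proof (cases "b \<le> s")
      case True
      then have sb: "s \<in> {b..b + c}" using s by simp
      have "(v has_vector_derivative F (state (t + b) v (s - b))) (at (s - b) within {0..c})"
        using v sb by (simp add: solves_def p fb)
      moreover have "state (t + b) v (s - b) = state t w s" using swv[of "s - b"] sb by simp
      moreover have "(\<lambda>r. r - b) ` {b..b + c} = {0..c}" by simp
      ultimately have "(v has_vector_derivative F (state t w s)) (at (s - b) within (\<lambda>r. r - b) ` {b..b + c})"
        by simp
      moreover have "((\<lambda>r. r - b) has_vector_derivative 1) (at s within {b..b + c})"
        using has_vector_derivative_diff[OF has_vector_derivative_id has_vector_derivative_const] by simp
      ultimately have "(v \<circ> (\<lambda>r. r - b) has_vector_derivative 1 *\<^sub>R F (state t w s)) (at s within {b..b + c})"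
        by (rule vector_diff_chain_within[rotated])
      then have "(v \<circ> (\<lambda>r. r - b) has_vector_derivative F (state t w s)) (at s within {b..b + c})"
        by simp
      then show ?thesis
      proof (rule has_vector_derivative_transform[OF sb, rotated])
        fix r assume "r \<in> {b..b + c}"
        then show "w r = (v \<circ> (\<lambda>r. r - b)) r" using w0[of "r - b"] by simp
      qed
    qed (simp add: has_vector_derivative_outside)
    have "{0..b} \<union> {b..b + c} = {0..b + c}" using b c by auto
    with has_vector_derivative_Un[OF 1 2]
    show "(w has_vector_derivative F (state t w s)) (at s within {0..b + c})" by simp
  qed
  with sw swv show thesis by (intro that[of w]) (simp_all add: p)
qed

lemma solves_0:
  assumes "p \<in> A"
  shows "solves p 0 (snd p)"
proof -
  have "snd p \<in> extensional I" using A_cont_maps[of "fst p" "snd p"] assms by (simp add: cont_maps_def)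
  then have "seg I 0 (snd p) = snd p" by (intro seg_0_eqI) auto
  moreover have "(snd p has_vector_derivative D) (at 0 within {0::real})" for D
    by (rule has_vector_derivative_trivial) (simp add: at_within_def principal_eq_bot_iff)
  ultimately show ?thesis using assms by (simp add: solves_def state_def)
qed

text \<open>If solutions starting arbitrarily close to \<open>q\<close> stayed away from the solution \<open>x\<close> of \<open>q\<close>, then a
  subsequence of them would converge to another solution of \<open>q\<close>, against uniqueness. The time
  \<open>\<delta>\<close> is the same for all \<open>q\<close> near \<open>p\<close>, which allows the result to be continued in time.\<close>

lemma dependence_local:
  assumes p: "p \<in> A"
  obtains \<delta> d where "0 < \<delta>" "0 < d"
    "\<forall>q\<in>A \<inter> nbd I d p. \<exists>x. solves q \<delta> x"
    "\<forall>q\<in>A \<inter> nbd I d p. \<forall>x \<epsilon>. solves q \<delta> x \<longrightarrow> 0 < \<epsilon> \<longrightarrow>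
      (\<exists>e>0. \<forall>q'\<in>A \<inter> nbd I e q. \<exists>y. solves q' \<delta> y \<and>
        (\<forall>s\<in>{0..\<delta>}. state (fst q') y s \<in> nbd I \<epsilon> (state (fst q) x s)))"
proof -
  obtain \<delta> d B where \<delta>: "0 < \<delta>" and d: "0 < d" and B: "0 \<le> B"
    and tr: "\<And>q. q \<in> nbd I d p \<Longrightarrow> trapped q B \<delta>"
    using trapped_nearby[of p] p A_subset by blast
  have \<delta>0: "0 \<le> \<delta>" using \<delta> by simp
  have half: "nbd I (d / 2) p \<subseteq> nbd I d p" using d by (intro nbd_mono) auto
  show thesis
  proof (rule that[of \<delta> "d / 2"], goal_cases)
    case 3
    show ?case
      using exists_solution_trapped[OF _ \<delta>0 B tr] half by blast
  next
    case 4
    show ?case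
    proof (intro ballI allI impI)
      fix q x and \<epsilon> :: real
      assume "q \<in> A \<inter> nbd I (d / 2) p"
      then have q: "q \<in> A" "q \<in> nbd I (d / 2) p" by auto
      assume x: "solves q \<delta> x" and \<epsilon>: "0 < \<epsilon>"
      show "\<exists>e>0. \<forall>q'\<in>A \<inter> nbd I e q. \<exists>y. solves q' \<delta> y \<and>
          (\<forall>s\<in>{0..\<delta>}. state (fst q') y s \<in> nbd I \<epsilon> (state (fst q) x s))"
      proof (rule ccontr)
        assume neg: "\<not> ?thesis"
        define e where "e n = min (min \<epsilon> (d / 2)) (1 / real (Suc n))" for n
        have e: "0 < e n" "e n \<le> \<epsilon>" "e n \<le> d / 2" "e n \<le> 1 / real (Suc n)" for n
          using d \<epsilon> by (auto simp: e_def)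
        have "\<forall>n. \<exists>q'. q' \<in> A \<and> q' \<in> nbd I (e n) q \<and> (\<forall>y. solves q' \<delta> y \<longrightarrow>
            \<not> (\<forall>s\<in>{0..\<delta>}. state (fst q') y s \<in> nbd I \<epsilon> (state (fst q) x s)))"
          using neg e(1) by blast
        then obtain Q where Q: "\<And>n. Q n \<in> A" "\<And>n. Q n \<in> nbd I (e n) q"
          and far: "\<And>n y. solves (Q n) \<delta> y \<Longrightarrow>
            \<not> (\<forall>s\<in>{0..\<delta>}. state (fst (Q n)) y s \<in> nbd I \<epsilon> (state (fst q) x s))"
          by metis
        have trQ: "trapped (Q n) B \<delta>" for n
        proof (rule tr)
          have "Q n \<in> nbd I (d / 2) q" using Q(2)[of n] nbd_mono[OF e(1,3)] by blast
          then show "Q n \<in> nbd I d p" using nbd_triangle[OF q(2), of "Q n" "d / 2"] d by simp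
        qed
        have "\<forall>n. \<exists>y. solves (Q n) \<delta> y \<and> lip_ext (snd (Q n)) B \<delta> y"
          using exists_solution_trapped[OF Q(1) \<delta>0 B trQ] by metis
        then obtain y where y: "\<And>n. solves (Q n) \<delta> (y n)" "\<And>n. lip_ext (snd (Q n)) B \<delta> (y n)"
          by metis
        have exact: "norm (y n s - snd (Q n) 0 - integral {0..s} (\<lambda>r. F (state (fst (Q n)) (y n) r))) \<le> 0"
          if s: "s \<in> {0..\<delta>}" for n s
        proof -
          have "((\<lambda>r. F (state (fst (Q n)) (y n) r)) has_integral y n s - y n 0) {0..s}"
            using solves_restrict[OF y(1), of s n] s
            by (intro fundamental_theorem_of_calculus) (auto simp: solves_def)
          then show ?thesis using lip_ext_0[OF y(2)[of n]] by (simp add: integral_unique)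
        qed
        have Qn: "Q n \<in> nbd I (1 / real (Suc n)) q" for n
          using Q(2)[of n] nbd_mono[OF e(1,4)] by blast
        obtain z k where k: "strict_mono (k :: nat \<Rightarrow> nat)" and z: "solves q \<delta> z"
          and lim: "\<And>e. 0 < e \<Longrightarrow> \<exists>N. \<forall>n\<ge>N. \<forall>s\<in>{0..\<delta>}. norm (y (k n) s - z s) < e"
          by (rule limit_of_approximations[OF q(1) \<delta>0 B tr[OF subsetD[OF half q(2)]] Qn trQ y(2)
                exact tendsto_const]) (assumption, blast)
        have xz: "z s = x s" if "s \<in> {0..\<delta>}" for s
          using solves_unique[OF z x that] .
        obtain N where N: "\<forall>n\<ge>N. \<forall>s\<in>{0..\<delta>}. norm (y (k n) s - z s) < \<epsilon>" using lim[OF \<epsilon>] by blast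
        have "state (fst (Q (k N))) (y (k N)) s \<in> nbd I \<epsilon> (state (fst q) x s)" if "s \<in> {0..\<delta>}" for s
        proof (rule state_near[OF _ _ _ solves_continuous[OF y(1)] _ that])
          show "Q (k N) \<in> nbd I \<epsilon> q" using Q(2)[of "k N"] nbd_mono[OF e(1,2)] by blast
          show "seg I 0 (y (k N)) = snd (Q (k N))" "seg I 0 x = snd q"
            using y(1)[of "k N"] x by (simp_all add: solves_def)
          show "norm (y (k N) r - x r) < \<epsilon>" if "r \<in> {0..\<delta>}" for r
            using N that xz by auto
        qed
        with far[OF y(1)] show False by blast
      qed
    qed
  qed (use \<delta> d in auto)
qed

lemma solves_extend:
  assumes "solves p b u" "0 \<le> b"
  obtains c v where "b < c" "solves p c v"
proof -
  have A: "state (fst p) u b \<in> A" using assms by (auto simp: solves_def)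
  then have "state (fst p) u b \<in> nbd I d (state (fst p) u b)" if "0 < d" for d
    using nbd_self[OF that, of "seg I b u" I "fst p + b"] A_cont_maps by (simp add: state_def)
  then obtain \<delta> v where v: "0 < \<delta>" "solves (state (fst p) u b) \<delta> v"
    using dependence_local[OF A] A by (metis IntI)
  show thesis
    using solves_concat[OF assms(1) v(2) assms(2)] v(1) that[of "b + \<delta>"]
    by (metis less_add_same_cancel1 less_imp_le)
qed

text \<open>Let \<open>\<sigma>\<close> be the supremum of the times up to which the claim holds. The local result near the
  state at \<open>\<sigma>\<close> applies to the state at some time \<open>s \<le> \<sigma>\<close> for which the claim is known, and
  leads from there beyond \<open>\<sigma>\<close> unless the end \<open>a\<close> has been reached.\<close>

lemma dependence:
  assumes x: "solves p a x" and a: "0 \<le> a" and \<epsilon>: "0 < \<epsilon>"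
  shows "\<exists>d>0. \<forall>q\<in>A \<inter> nbd I d p. \<exists>y. solves q a y \<and>
    (\<forall>s\<in>{0..a}. state (fst q) y s \<in> nbd I \<epsilon> (state (fst p) x s))"
proof -
  obtain t \<phi> where p: "p = (t, \<phi>)" by (cases p)
  define G where "G b \<longleftrightarrow> (\<forall>\<epsilon>>0. \<exists>d>0. \<forall>q\<in>A \<inter> nbd I d p. \<exists>y. solves q b y \<and>
    (\<forall>s\<in>{0..b}. state (fst q) y s \<in> nbd I \<epsilon> (state t x s)))" for b
  have xA: "state t x s \<in> A" if "s \<in> {0..a}" for s using x that by (simp add: solves_def p)
  have state0: "state (fst q) y 0 = q" if "solves q b y" for q y b
    using that by (cases q) (simp add: state_def solves_def)
  have "G 0"
    unfolding G_def
  proof (intro allI impI)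
    fix \<epsilon> :: real assume "0 < \<epsilon>"
    moreover have "solves q 0 (snd q) \<and>
        (\<forall>s\<in>{0..0}. state (fst q) (snd q) s \<in> nbd I \<epsilon> (state t x s))" if "q \<in> A \<inter> nbd I \<epsilon> p" for q
      using that solves_0[of q] state0[OF solves_0, of q] state0[OF x] by (simp add: p)
    ultimately show "\<exists>d>0. \<forall>q\<in>A \<inter> nbd I d p. \<exists>y. solves q 0 y \<and>
        (\<forall>s\<in>{0..0}. state (fst q) y s \<in> nbd I \<epsilon> (state t x s))"
      by blast
  qed
  define S where "S = {s \<in> {0..a}. G s}"
  define \<sigma> where "\<sigma> = Sup S"
  have S: "0 \<in> S" "bdd_above S" using \<open>G 0\<close> a by (auto simp: S_def intro: bdd_aboveI[of _ a])
  have \<sigma>: "\<sigma> \<in> {0..a}"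
    using S a unfolding \<sigma>_def by (auto intro: cSup_upper intro!: cSup_least simp: S_def)
  obtain \<delta> d where \<delta>: "0 < \<delta>" and d: "0 < d"
    and ex: "\<forall>q\<in>A \<inter> nbd I d (state t x \<sigma>). \<exists>x. solves q \<delta> x"
    and dep: "\<forall>q\<in>A \<inter> nbd I d (state t x \<sigma>). \<forall>x \<epsilon>. solves q \<delta> x \<longrightarrow> 0 < \<epsilon> \<longrightarrow>
      (\<exists>e>0. \<forall>q'\<in>A \<inter> nbd I e q. \<exists>y. solves q' \<delta> y \<and>
        (\<forall>s\<in>{0..\<delta>}. state (fst q') y s \<in> nbd I \<epsilon> (state (fst q) x s)))"
    by (rule dependence_local[OF xA[OF \<sigma>]])
  obtain dc where dc: "0 < dc" "\<And>s. s \<in> {0..a} \<Longrightarrow> \<bar>s - \<sigma>\<bar> < dc \<Longrightarrow> state t x s \<in> nbd I d (state t x \<sigma>)"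
    using seg_curve_uniformly_continuous[OF I solves_cont_maps[OF x a] solves_continuous[OF x] d, of t] \<sigma>
    unfolding state_def by metis
  have "\<sigma> - min \<delta> dc < Sup S" using \<delta> dc by (simp add: \<sigma>_def)
  then obtain s where s: "s \<in> S" "\<sigma> - min \<delta> dc < s"
    using less_cSup_iff[of S] S by blast
  then have s\<sigma>: "s \<le> \<sigma>" unfolding \<sigma>_def using S by (intro cSup_upper)
  have sa: "s \<in> {0..a}" "G s" using s by (auto simp: S_def)
  define q where "q = state t x s"
  have q: "q \<in> A" "q \<in> nbd I d (state t x \<sigma>)"
    using xA dc(2) sa s s\<sigma> by (auto simp: q_def)
  have fst_q: "fst q = t + s" by (simp add: q_def state_def)
  obtain z where z: "solves q \<delta> z" using ex q by blast
  define r where "r = min \<delta> (a - s)"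
  have r: "0 \<le> r" "r \<le> \<delta>" "r \<le> a - s" using \<delta> sa by (auto simp: r_def)
  have xs: "solves q (a - s) (\<lambda>r. x (s + r))"
    using solves_restart[OF x, of s] sa by (simp add: q_def p)
  have zx: "state (fst q) z r' = state t x (s + r')" if "r' \<in> {0..r}" for r'
  proof -
    have "state (t + s) z r' = state (t + s) (\<lambda>r. x (s + r)) r'"
      using solves_unique[OF solves_restrict[OF z r(2)] solves_restrict[OF xs r(3)]]
        solves_history[OF z xs] that by (intro state_cong[of _ _ r]) auto
    then show ?thesis by (simp add: fst_q state_shift)
  qed
  have "G (s + r)"
    unfolding G_def
  proof (intro allI impI)
    fix \<epsilon> :: real assume \<epsilon>: "0 < \<epsilon>"
    obtain e where e: "0 < e" "\<And>q'. q' \<in> A \<Longrightarrow> q' \<in> nbd I e q \<Longrightarrow> \<exists>y. solves q' \<delta> y \<and>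
        (\<forall>s\<in>{0..\<delta>}. state (fst q') y s \<in> nbd I \<epsilon> (state (fst q) z s))"
      using dep q z \<epsilon> by blast
    have "0 < min e \<epsilon>" using e \<epsilon> by simp
    then obtain d1 where d1: "0 < d1" "\<And>q1. q1 \<in> A \<inter> nbd I d1 p \<Longrightarrow> \<exists>y. solves q1 s y \<and>
        (\<forall>s'\<in>{0..s}. state (fst q1) y s' \<in> nbd I (min e \<epsilon>) (state t x s'))"
      using sa(2) unfolding G_def by meson
    have "\<exists>w. solves q1 (s + r) w \<and>
        (\<forall>s'\<in>{0..s + r}. state (fst q1) w s' \<in> nbd I \<epsilon> (state t x s'))" if q1: "q1 \<in> A \<inter> nbd I d1 p" for q1
    proof -
      obtain y where y: "solves q1 s y"
        "\<And>s'. s' \<in> {0..s} \<Longrightarrow> state (fst q1) y s' \<in> nbd I (min e \<epsilon>) (state t x s')"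
        using d1(2)[OF q1] by blast
      have ss: "s \<in> {0..s}" using sa by simp
      have "state (fst q1) y s \<in> A" using y(1) ss unfolding solves_def by blast
      moreover have "state (fst q1) y s \<in> nbd I e q"
        using subsetD[OF nbd_mono[OF \<open>0 < min e \<epsilon>\<close> min.cobounded1] y(2)[OF ss]] by (simp add: q_def)
      ultimately obtain y' where y': "solves (state (fst q1) y s) \<delta> y'"
        "\<And>r. r \<in> {0..\<delta>} \<Longrightarrow> state (fst (state (fst q1) y s)) y' r \<in> nbd I \<epsilon> (state (fst q) z r)"
        using e(2) by blast
      have s0: "0 \<le> s" using sa by simp
      obtain w where w: "solves q1 (s + r) w" "\<forall>s'\<le>s. state (fst q1) w s' = state (fst q1) y s'"
        "\<forall>r'\<in>{0..r}. state (fst q1) w (s + r') = state (fst q1 + s) y' r'"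
        by (rule solves_concat[OF y(1) solves_restrict[OF y'(1) r(2)] s0 r(1)])
      have "state (fst q1) w s' \<in> nbd I \<epsilon> (state t x s')" if s': "s' \<in> {0..s + r}" for s'
      proof (cases "s' \<le> s")
        case True
        then show ?thesis
          using subsetD[OF nbd_mono[OF \<open>0 < min e \<epsilon>\<close> min.cobounded2] y(2)[of s']] w(2) True s'
          by simp
      next
        case False
        then have r': "s' - s \<in> {0..r}" using s' by auto
        then have "state (fst q1) w (s + (s' - s)) = state (fst q1 + s) y' (s' - s)"
          using w(3) by blast
        moreover have "fst (state (fst q1) y s) = fst q1 + s" by (simp add: state_def)
        ultimately have "state (fst q1) w s' \<in> nbd I \<epsilon> (state (fst q) z (s' - s))"
          using y'(2)[of "s' - s"] r' r by simp
        then show ?thesis using zx[OF r'] by simp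
      qed
      with w(1) show ?thesis by blast
    qed
    with d1(1) show "\<exists>d>0. \<forall>q1\<in>A \<inter> nbd I d p. \<exists>y. solves q1 (s + r) y \<and>
        (\<forall>s'\<in>{0..s + r}. state (fst q1) y s' \<in> nbd I \<epsilon> (state t x s'))" by blast
  qed
  then have "s + r \<in> S" using sa r by (auto simp: S_def)
  then have "s + r \<le> \<sigma>" unfolding \<sigma>_def using S by (intro cSup_upper)
  then have "r < \<delta>" using s by simp
  then have "s + r = a" by (auto simp: r_def)
  with \<open>G (s + r)\<close> \<epsilon> show ?thesis by (simp add: G_def p)
qed

section \<open>Maximal solutions\<close>

definition lifetime :: "real \<times> (real \<Rightarrow> 'a) \<Rightarrow> ereal"
  where "lifetime p = Sup (ereal ` {b. 0 \<le> b \<and> (\<exists>u. solves p b u)})"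

text \<open>A solution is chosen anew for each time; uniqueness makes the choices agree.\<close>

definition flow :: "real \<times> (real \<Rightarrow> 'a) \<Rightarrow> real \<Rightarrow> 'a"
  where "flow p s = (if s \<le> 0 then snd p s else (SOME u. solves p s u) s)"

definition max_interval :: "real \<times> (real \<Rightarrow> 'a) \<Rightarrow> real set"
  where "max_interval p = {t. fst p \<le> t \<and> ereal t < ereal (fst p) + lifetime p}"

definition max_solution :: "real \<times> (real \<Rightarrow> 'a) \<Rightarrow> real \<Rightarrow> 'a"
  where "max_solution p = restrict (\<lambda>t. flow p (t - fst p)) (max_interval p + I)"

text \<open>The inequality is strict since a solution on a compact interval can always be continued.\<close>

lemma less_lifetime_iff:
  assumes "0 \<le> b"
  shows "ereal b < lifetime p \<longleftrightarrow> (\<exists>u. solves p b u)"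
proof
  assume "ereal b < lifetime p"
  then obtain c u where "b < c" "solves p c u"
    unfolding lifetime_def less_Sup_iff by auto
  then show "\<exists>u. solves p b u" using solves_restrict[of p c u b] by auto
next
  assume "\<exists>u. solves p b u"
  then obtain c v where c: "b < c" "solves p c v" using solves_extend assms by metis
  then have "ereal c \<le> lifetime p"
    unfolding lifetime_def using assms by (intro Sup_upper) auto
  then show "ereal b < lifetime p" using c(1) by (metis ereal_less(2) less_ereal.simps(1) order_less_le_trans)
qed

lemma flow_eq:
  assumes u: "solves p b u" and s: "s \<in> {0..b} \<or> s \<in> I"
  shows "flow p s = u s"
proof (cases "s \<le> 0")
  case True
  then have "s \<in> I" using s zero_in_I by (cases "s = 0") auto
  then have "seg I 0 u s = u s" by (simp add: seg_apply)
  then show ?thesis using True u by (simp add: flow_def solves_def)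
next
  case False
  then have sb: "0 \<le> s" "s \<le> b" using s history_intervalD(3)[OF I, of s] by auto
  have us: "solves p s u" using solves_restrict[OF u sb(2)] .
  then have "solves p s (SOME u. solves p s u)" by (rule someI[of "solves p s"])
  from solves_unique[OF this us, of s] False sb show ?thesis by (simp add: flow_def)
qed

lemma solves_cong:
  assumes u: "solves p b u" and eq: "\<And>\<theta>. \<theta> \<in> I \<Longrightarrow> u \<theta> = v \<theta>" "\<And>r. r \<in> {0..b} \<Longrightarrow> u r = v r"
  shows "solves p b v"
  unfolding solves_def
proof (intro conjI ballI)
  have "seg I 0 v = seg I 0 u" using eq(1) by (intro seg_cong) simp
  then show "seg I 0 v = snd p" using u by (simp add: solves_def)
  fix s assume s: "s \<in> {0..b}"
  have st: "state (fst p) v s = state (fst p) u s"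
    by (rule state_cong[OF _ _ s]) (use eq in auto)
  then show "state (fst p) v s \<in> A" using u s by (simp add: solves_def)
  have "(u has_vector_derivative F (state (fst p) u s)) (at s within {0..b})"
    using u s by (simp add: solves_def)
  then show "(v has_vector_derivative F (state (fst p) v s)) (at s within {0..b})"
    unfolding st by (rule has_vector_derivative_transform[OF s, rotated]) (simp add: eq)
qed

lemma solves_flow:
  assumes "0 \<le> b" "ereal b < lifetime p"
  shows "solves p b (flow p)"
proof -
  obtain u where u: "solves p b u" using assms less_lifetime_iff by blast
  then show ?thesis by (rule solves_cong) (use flow_eq[OF u] in auto)
qed

lemma lifetime_dense:
  assumes "0 \<le> b" "ereal b < lifetime p"
  obtains c where "b < c" "ereal c < lifetime p"
proof -
  obtain c v where c: "b < c" "solves p c v"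
    by (rule solves_extend[OF solves_flow[OF assms] assms(1)])
  then have "ereal c < lifetime p" using less_lifetime_iff[of c p] assms(1) by auto
  with c(1) show thesis by (rule that)
qed

lemma lifetime_pos: "p \<in> A \<Longrightarrow> 0 < lifetime p"
  using less_lifetime_iff[of 0 p] solves_0[of p] unfolding zero_ereal_def by blast

lemma mem_max_interval:
  "t \<in> max_interval p \<longleftrightarrow> 0 \<le> t - fst p \<and> ereal (t - fst p) < lifetime p"
  by (cases "lifetime p") (auto simp: max_interval_def)

lemma max_solution_eq:
  "t \<in> max_interval p \<Longrightarrow> \<theta> \<in> I \<Longrightarrow> max_solution p (t + \<theta>) = flow p (t - fst p + \<theta>)"
  by (auto simp: max_solution_def algebra_simps)

lemma seg_max_solution:
  assumes "t \<in> max_interval p"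
  shows "(t, seg I t (max_solution p)) = state (fst p) (flow p) (t - fst p)"
  using seg_cong[of I "max_solution p" t "flow p" "t - fst p"] max_solution_eq[OF assms]
  by (simp add: state_def)

lemma C1_solution_solves:
  assumes x: "C1_solution I A F p (J, x)" and b: "0 \<le> b" "fst p + b \<in> J"
  shows "solves p b (\<lambda>r. x (fst p + r))"
proof -
  obtain t0 \<phi> where p: "p = (t0, \<phi>)" by (cases p)
  have J: "is_interval J" "t0 \<in> J" "\<And>t. t \<in> J \<Longrightarrow> t0 \<le> t"
    and segx: "seg I t0 x = \<phi>" and xA: "\<And>t. t \<in> J \<Longrightarrow> (t, seg I t x) \<in> A"
    and der: "\<And>t. t \<in> J \<Longrightarrow> (x has_vector_derivative F (t, seg I t x)) (at t within J)"
    using x unfolding C1_solution_def solution_def p by auto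
  have sub: "(+) t0 ` {0..b} \<subseteq> J"
    using J(1,2) b mem_is_interval_1_I[OF J(1,2)] by (fastforce simp: p)
  have st: "state t0 (\<lambda>r. x (t0 + r)) s = (t0 + s, seg I (t0 + s) x)" for s
    using seg_cong[of I "\<lambda>r. x (t0 + r)" s x "t0 + s"] by (simp add: state_def add.assoc)
  show ?thesis
    unfolding solves_def p fst_conv snd_conv st
  proof (intro conjI ballI)
    show "seg I 0 (\<lambda>r. x (t0 + r)) = \<phi>" using st[of 0] segx by (simp add: state_def)
    fix s assume s: "s \<in> {0..b}"
    then have sJ: "t0 + s \<in> J" using sub by auto
    show "(t0 + s, seg I (t0 + s) x) \<in> A" using xA[OF sJ] .
    have "(x has_vector_derivative F (t0 + s, seg I (t0 + s) x)) (at (t0 + s) within (+) t0 ` {0..b})"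
      using der[OF sJ] sub by (rule has_vector_derivative_within_subset)
    from vector_diff_chain_within[OF _ this, of 1]
    show "((\<lambda>r. x (t0 + r)) has_vector_derivative F (t0 + s, seg I (t0 + s) x)) (at s within {0..b})"
      by (simp add: o_def has_vector_derivative_add[OF has_vector_derivative_const
            has_vector_derivative_id, simplified])
  qed
qed

text \<open>The derivative is continuous because it is \<open>F\<close> along the continuous curve
  of states.\<close>

lemma C1_solution_max:
  assumes p: "p \<in> A"
  shows "C1_solution I A F p (max_interval p, max_solution p)"
proof -
  obtain t0 \<phi> where pe: "p = (t0, \<phi>)" by (cases p)
  let ?J = "max_interval p" and ?x = "max_solution p"
  have t0: "t0 \<in> ?J" using lifetime_pos[OF p] by (simp add: mem_max_interval pe zero_ereal_def)
  obtain c where c: "0 < c" "ereal c < lifetime p"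
    using lifetime_dense[of 0 p] lifetime_pos[OF p] by (auto simp: zero_ereal_def)
  have cJ: "t0 + c \<in> ?J" using c by (simp add: mem_max_interval pe)
  have int: "is_interval ?J"
    unfolding is_interval_1
  proof (intro ballI allI impI)
    fix a b x assume "a \<in> ?J" "b \<in> ?J" "a \<le> x \<and> x \<le> b"
    then show "x \<in> ?J"
      using order_le_less_trans[of "ereal (x - fst p)" "ereal (b - fst p)" "lifetime p"]
      by (simp add: mem_max_interval)
  qed
  \<comment> \<open>Near \<open>t\<close> the interval looks like a compact one on which \<open>flow p\<close> is a solution.\<close>
  have near: "\<exists>b. 0 \<le> b \<and> solves p b (flow p) \<and> t < t0 + b" if t: "t \<in> ?J" for t
  proof -
    obtain b where b: "t - fst p < b" "ereal b < lifetime p"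
      using lifetime_dense t unfolding mem_max_interval by blast
    then show ?thesis
      using t solves_flow[of b p] by (intro exI[of _ b]) (auto simp: mem_max_interval pe)
  qed
  have sub: "?J \<subseteq> {t0..t0 + b} \<union> {t0 + b..}" for b
    by (auto simp: mem_max_interval pe)
  have A: "(t, seg I t ?x) \<in> A" if t: "t \<in> ?J" for t
  proof -
    obtain b where "0 \<le> b" "solves p b (flow p)" "t < t0 + b" using near[OF t] by blast
    then show ?thesis using t by (simp add: seg_max_solution solves_def pe mem_max_interval)
  qed
  have der: "(?x has_vector_derivative F (t, seg I t ?x)) (at t within ?J)" if t: "t \<in> ?J" for t
  proof -
    obtain b where b: "0 \<le> b" "solves p b (flow p)" "t < t0 + b" using near[OF t] by blast
    have im: "(\<lambda>r. r - t0) ` {t0..t0 + b} = {0..b}" by simp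
    have "t - t0 \<in> {0..b}" using t b by (simp add: mem_max_interval pe)
    then have "(flow p has_vector_derivative F (t, seg I t ?x)) (at (t - t0) within (\<lambda>r. r - t0) ` {t0..t0 + b})"
      unfolding im using b(2) t by (simp add: seg_max_solution solves_def pe)
    moreover have "((\<lambda>r. r - t0) has_vector_derivative 1) (at t within {t0..t0 + b})"
      using has_vector_derivative_diff[OF has_vector_derivative_id has_vector_derivative_const] by simp
    ultimately have "(flow p \<circ> (\<lambda>r. r - t0) has_vector_derivative 1 *\<^sub>R F (t, seg I t ?x))
        (at t within {t0..t0 + b})"
      by (rule vector_diff_chain_within[rotated])
    then have "((\<lambda>r. flow p (r - t0)) has_vector_derivative F (t, seg I t ?x)) (at t within {t0..t0 + b})"
      by (simp add: o_def)
    moreover have "((\<lambda>r. flow p (r - t0)) has_vector_derivative F (t, seg I t ?x)) (at t within {t0 + b..})"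
      using b(3) by (intro has_vector_derivative_outside) auto
    ultimately have "((\<lambda>r. flow p (r - t0)) has_vector_derivative F (t, seg I t ?x)) (at t within ?J)"
      using has_vector_derivative_Un has_vector_derivative_within_subset[OF _ sub] by blast
    then show ?thesis
      by (rule has_vector_derivative_transform[OF t, rotated])
        (use max_solution_eq[OF _ zero_in_I, of _ p] in \<open>simp add: pe\<close>)
  qed
  have cont: "continuous_on ?J (\<lambda>t. F (t, seg I t ?x))"
    unfolding continuous_on_def
  proof
    fix t assume t: "t \<in> ?J"
    obtain b where b: "0 \<le> b" "solves p b (flow p)" "t < t0 + b" using near[OF t] by blast
    let ?g = "\<lambda>t. F (state t0 (flow p) (t - t0))"
    have "continuous_on {t0..t0 + b} ?g"
    proof (rule continuous_on_compose2[where g = "\<lambda>s. F (state t0 (flow p) s)" and f = "\<lambda>t. t - t0"])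
      show "continuous_on {0..b} (\<lambda>s. F (state t0 (flow p) s))"
        using solves_F_continuous[OF b(2,1)] by (simp add: pe)
      show "continuous_on {t0..t0 + b} (\<lambda>t. t - t0)" by (intro continuous_intros)
    qed auto
    then have "(?g \<longlongrightarrow> ?g t) (at t within {t0..t0 + b})"
      using t b by (simp add: continuous_on_def mem_max_interval pe)
    moreover have "at t within {t0 + b..} = bot"
      using b(3) by (intro not_in_closure_trivial_limitI) simp
    ultimately have "(?g \<longlongrightarrow> ?g t) (at t within ({t0..t0 + b} \<union> {t0 + b..}))"
      by (intro Lim_Un) auto
    then have "(?g \<longlongrightarrow> ?g t) (at t within ?J)"
      using sub by (rule tendsto_within_subset)
    then have "(?g \<longlongrightarrow> F (t, seg I t ?x)) (at t within ?J)"
      using seg_max_solution[OF t] by (simp add: pe)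
    then show "((\<lambda>t. F (t, seg I t ?x)) \<longlongrightarrow> F (t, seg I t ?x)) (at t within ?J)"
      by (rule Lim_transform_within[OF _ zero_less_one]) (simp add: seg_max_solution pe)
  qed
  have "solves p 0 (flow p)" using solves_flow[of 0 p] lifetime_pos[OF p] by (simp add: zero_ereal_def)
  then have "seg I t0 ?x = \<phi>"
    using seg_max_solution[OF t0] by (simp add: pe state_def solves_def)
  moreover have "\<forall>t\<in>?J. t0 \<le> t" by (simp add: mem_max_interval pe)
  moreover have "?J \<noteq> {t0}" using cJ c(1) by auto
  moreover have "?x \<in> extensional (?J + I)" by (simp add: max_solution_def)
  ultimately have "solution I A F (t0, \<phi>) (?J, ?x)"
    unfolding solution_def prod.case using int t0 A der by blast
  then show ?thesis
    unfolding C1_solution_def pe prod.case using der cont unfolding pe by blast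
qed

text \<open>The solution \<open>max_solution p\<close> is not only maximal but greatest; hence it is the only maximal
  one.\<close>

lemma C1_solution_sol_le:
  assumes x: "C1_solution I A F p (J, x)"
  shows "sol_le (J, x) (max_interval p, max_solution p)"
proof -
  have "t \<in> max_interval p \<and> x t = max_solution p t" if t: "t \<in> J" for t
  proof -
    have b: "0 \<le> t - fst p"
      using x t by (cases p) (auto simp: C1_solution_def solution_def)
    have s: "solves p (t - fst p) (\<lambda>r. x (fst p + r))"
      using C1_solution_solves[OF x b] t by simp
    then have tm: "t \<in> max_interval p"
      using less_lifetime_iff[OF b] b by (auto simp: mem_max_interval)
    then show ?thesis
      using flow_eq[OF s, of "t - fst p"] b max_solution_eq[OF tm zero_in_I] by simp
  qed
  then show ?thesis by (auto simp: sol_le_def)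
qed

text \<open>The order \<open>sol_le\<close> compares solutions on \<open>J\<close> only. The remaining points of \<open>J + I\<close> lie to the
  left of the initial instant, where all solutions follow the initial history.\<close>

lemma C1_solution_eqI:
  assumes x: "C1_solution I A F p (J, x)" and y: "C1_solution I A F p (J, y)"
    and eq: "\<And>t. t \<in> J \<Longrightarrow> x t = y t"
  shows "x = y"
proof
  fix r
  obtain t0 \<phi> where p: "p = (t0, \<phi>)" by (cases p)
  have J: "is_interval J" "t0 \<in> J" and ext: "x \<in> extensional (J + I)" "y \<in> extensional (J + I)"
    and segs: "seg I t0 x = \<phi>" "seg I t0 y = \<phi>"
    using x y unfolding C1_solution_def solution_def p by auto
  show "x r = y r"
  proof (cases "r \<in> J + I")
    case True
    then obtain t \<theta> where r: "r = t + \<theta>" "t \<in> J" "\<theta> \<in> I" by (auto simp: set_plus_def)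
    show ?thesis
    proof (cases "t0 \<le> r")
      case True
      have "r \<le> t" using r history_intervalD(3)[OF I r(3)] by simp
      then have "r \<in> J" using mem_is_interval_1_I[OF J r(2) True] by simp
      then show ?thesis by (rule eq)
    next
      case False
      have "t0 \<le> t" using x r(2) by (auto simp: C1_solution_def solution_def p)
      then have "r - t0 \<in> I" using False r history_intervalD(4)[OF I r(3), of "r - t0"] by simp
      then show ?thesis using seg_apply[of "r - t0" I t0] segs by (metis add_diff_cancel_left' diff_add_cancel add.commute)
    qed
  next
    case False
    then show ?thesis using ext by (simp add: extensional_def)
  qed
qed

lemma maximal_C1_solution_iff:
  assumes p: "p \<in> A"
  shows "maximal_C1_solution I A F p s \<longleftrightarrow> s = (max_interval p, max_solution p)"
proof
  assume s: "maximal_C1_solution I A F p s"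
  obtain J x where Jx: "s = (J, x)" by (cases s)
  then have "sol_le s (max_interval p, max_solution p)"
    using s C1_solution_sol_le by (auto simp: maximal_C1_solution_def)
  then show "s = (max_interval p, max_solution p)"
    using s C1_solution_max[OF p] by (auto simp: maximal_C1_solution_def)
next
  assume s: "s = (max_interval p, max_solution p)"
  have "s' = s" if s': "C1_solution I A F p s'" "sol_le s s'" for s'
  proof -
    obtain J x where Jx: "s' = (J, x)" by (cases s')
    have "J = max_interval p" and eq: "\<And>t. t \<in> J \<Longrightarrow> x t = max_solution p t"
      using s' C1_solution_sol_le[of p J x] by (auto simp: Jx s sol_le_def)
    then have "x = max_solution p"
      using C1_solution_eqI[of p J x "max_solution p"] s'(1) C1_solution_max[OF p] by (simp add: Jx)
    then show ?thesis using \<open>J = max_interval p\<close> by (simp add: Jx s)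
  qed
  then show "maximal_C1_solution I A F p s"
    using C1_solution_max[OF p] by (auto simp: maximal_C1_solution_def s)
qed

section \<open>The solution process\<close>

definition flow_dom :: "(real \<times> real \<times> (real \<Rightarrow> 'a)) set"
  where "flow_dom = {(s, p). p \<in> A \<and> 0 \<le> s \<and> ereal s < lifetime p}"

definition state_flow :: "real \<times> real \<times> (real \<Rightarrow> 'a) \<Rightarrow> real \<times> (real \<Rightarrow> 'a)"
  where "state_flow = (\<lambda>(s, t, \<phi>). (t + s, seg I (t + s) (max_solution (t, \<phi>))))"

abbreviation state_space :: "(real \<times> (real \<Rightarrow> 'a)) topology"
  where "state_space \<equiv> subtopology (prod_topology euclideanreal (Hbar I)) A"

lemma topspace_state_space: "topspace state_space = A"
  using A_cont_maps by auto

lemma state_flow_eq: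
  assumes "(s, p) \<in> flow_dom" "solves p b u" "s \<le> b"
  shows "state_flow (s, p) = state (fst p) u s"
proof -
  obtain t \<phi> where p: "p = (t, \<phi>)" by (cases p)
  have "t + s \<in> max_interval p" using assms by (simp add: flow_dom_def mem_max_interval p)
  then have "state_flow (s, p) = state t (flow p) s"
    using seg_max_solution[of "t + s" p] by (simp add: state_flow_def p)
  also have "\<dots> = state t u s"
    using assms flow_eq[OF assms(2)] by (intro state_cong[of _ _ s]) (auto simp: flow_dom_def)
  finally show ?thesis by (simp add: p)
qed

lemma state_flow_A:
  assumes "(s, p) \<in> flow_dom"
  shows "state_flow (s, p) \<in> A"
proof -
  have s: "0 \<le> s" "ereal s < lifetime p" using assms by (auto simp: flow_dom_def)
  show ?thesis
    using state_flow_eq[OF assms solves_flow[OF s]] solves_flow[OF s] s by (simp add: solves_def)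
qed

lemma maximal_semiflow_state_flow: "maximal_semiflow state_space flow_dom state_flow"
  unfolding maximal_semiflow_def topspace_state_space
proof (intro conjI)
  show "state_flow \<in> flow_dom \<rightarrow> A" using state_flow_A by auto
  show "\<exists>T. (\<forall>x\<in>A. 0 < T x) \<and> flow_dom = {(t, x). x \<in> A \<and> 0 \<le> t \<and> ereal t < T x}"
    using lifetime_pos by (intro exI[of _ lifetime]) (auto simp: flow_dom_def)
  show "\<forall>x\<in>A. state_flow (0, x) = x"
  proof
    fix p assume p: "p \<in> A"
    have "(0, p) \<in> flow_dom" using p lifetime_pos[OF p] by (simp add: flow_dom_def zero_ereal_def)
    from state_flow_eq[OF this solves_0[OF p]] solves_0[OF p]
    show "state_flow (0, p) = p" by (simp add: state_def solves_def)
  qed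
  show "\<forall>t1 t2 x. (t1, x) \<in> flow_dom \<longrightarrow> (t2, state_flow (t1, x)) \<in> flow_dom \<longrightarrow>
      (t1 + t2, x) \<in> flow_dom \<and> state_flow (t1 + t2, x) = state_flow (t2, state_flow (t1, x))"
  proof (intro allI impI)
    fix t1 t2 p assume 1: "(t1, p) \<in> flow_dom" and 2: "(t2, state_flow (t1, p)) \<in> flow_dom"
    have t: "0 \<le> t1" "0 \<le> t2" "p \<in> A" using 1 2 by (auto simp: flow_dom_def)
    have s1: "solves p t1 (flow p)" using 1 by (intro solves_flow) (auto simp: flow_dom_def)
    define q where "q = state_flow (t1, p)"
    have q: "q = state (fst p) (flow p) t1" unfolding q_def by (rule state_flow_eq[OF 1 s1 order_refl])
    have s2: "solves q t2 (flow q)"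
      using 2 unfolding q_def[symmetric] by (intro solves_flow) (auto simp: flow_dom_def)
    obtain w where w: "solves p (t1 + t2) w"
      "\<forall>r\<in>{0..t2}. state (fst p) w (t1 + r) = state (fst p + t1) (flow q) r"
      by (rule solves_concat[OF s1 s2[unfolded q] t(1,2), folded q])
    have 3: "(t1 + t2, p) \<in> flow_dom"
      using w(1) t less_lifetime_iff[of "t1 + t2" p] by (auto simp: flow_dom_def)
    have "state_flow (t1 + t2, p) = state (fst p) w (t1 + t2)"
      by (rule state_flow_eq[OF 3 w(1) order_refl])
    also have "\<dots> = state (fst q) (flow q) t2" using w(2) t by (simp add: q state_def)
    also have "\<dots> = state_flow (t2, q)"
      using state_flow_eq[OF 2[folded q_def] s2 order_refl] by simp
    finally show "(t1 + t2, p) \<in> flow_dom \<and>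
        state_flow (t1 + t2, p) = state_flow (t2, state_flow (t1, p))"
      using 3 by (simp add: q_def)
  qed
qed

lemma openin_nbd_state_space:
  assumes "p \<in> A" "0 < d"
  shows "openin state_space (nbd I d p \<inter> A)"
proof -
  have "openin (prod_topology euclideanreal (Hbar I)) (nbd I d p)"
    using openin_nbd[OF I A_cont_maps[of "fst p" "snd p"] assms(2), of "fst p"] assms(1) by simp
  then show ?thesis unfolding openin_subtopology by blast
qed

lemma self_mem_nbd: "p \<in> A \<Longrightarrow> 0 < d \<Longrightarrow> p \<in> nbd I d p"
  using nbd_self[of d "snd p" I "fst p"] A_cont_maps[of "fst p" "snd p"] by simp

text \<open>Openness of the domain and continuity of the process are proved together. A solution that
  exists beyond \<open>s\<close>, up to \<open>a\<close>, makes all nearby ones exist up to \<open>a\<close> and stay close to it; the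
  remaining distance, from the time \<open>s'\<close> to \<open>s\<close>, is travelled on a single continuous curve.\<close>

lemma state_flow_continuous_at:
  assumes sp: "(s, p) \<in> flow_dom" and e: "0 < e"
  obtains U V where "openin (top_of_set {0..}) U" "openin state_space V" "s \<in> U" "p \<in> V"
    "U \<times> V \<subseteq> flow_dom" "\<And>s' q. s' \<in> U \<Longrightarrow> q \<in> V \<Longrightarrow> state_flow (s', q) \<in> nbd I e (state_flow (s, p))"
proof -
  have s: "p \<in> A" "0 \<le> s" "ereal s < lifetime p" using sp by (auto simp: flow_dom_def)
  obtain a where a: "s < a" "ereal a < lifetime p" using lifetime_dense[OF s(2,3)] by blast
  have a0: "0 \<le> a" using a s by simp
  have fl: "solves p a (flow p)" using solves_flow[OF a0 a(2)] .
  have e2: "0 < e / 2" using e by simp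
  obtain d where d: "0 < d" "\<And>q. q \<in> A \<inter> nbd I d p \<Longrightarrow> \<exists>y. solves q a y \<and>
      (\<forall>s\<in>{0..a}. state (fst q) y s \<in> nbd I (e / 2) (state (fst p) (flow p) s))"
    using dependence[OF fl a0 e2] by blast
  obtain dc where dc: "0 < dc" "\<And>s'. s' \<in> {0..a} \<Longrightarrow> \<bar>s' - s\<bar> < dc \<Longrightarrow>
      state (fst p) (flow p) s' \<in> nbd I (e / 2) (state (fst p) (flow p) s)"
    using seg_curve_uniformly_continuous[OF I solves_cont_maps[OF fl a0] solves_continuous[OF fl] e2, of "fst p"] s a
    unfolding state_def by (metis atLeastAtMost_iff less_imp_le)
  define U where "U = {0..} \<inter> ({..<a} \<inter> ball s dc)"
  define V where "V = nbd I d p \<inter> A"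
  have UV: "(s', q) \<in> flow_dom \<and> state_flow (s', q) \<in> nbd I e (state_flow (s, p))"
    if s': "s' \<in> U" and q: "q \<in> V" for s' q
  proof -
    obtain y where y: "solves q a y"
      "\<And>s. s \<in> {0..a} \<Longrightarrow> state (fst q) y s \<in> nbd I (e / 2) (state (fst p) (flow p) s)"
      using d(2)[of q] q unfolding V_def by blast
    have s'a: "s' \<in> {0..a}" "\<bar>s' - s\<bar> < dc" using s' by (auto simp: U_def dist_real_def)
    have "ereal a < lifetime q" using y(1) less_lifetime_iff[OF a0] by blast
    then have dom: "(s', q) \<in> flow_dom"
      using q s'a order_le_less_trans[of "ereal s'" "ereal a" "lifetime q"]
      by (simp add: flow_dom_def V_def)
    have "state (fst q) y s' \<in> nbd I (e / 2 + e / 2) (state (fst p) (flow p) s)"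
      using nbd_triangle[OF dc(2)[OF s'a] y(2)[OF s'a(1)] e2 e2] .
    then have "state_flow (s', q) \<in> nbd I e (state_flow (s, p))"
      using state_flow_eq[OF dom y(1)] state_flow_eq[OF sp fl] s'a a by simp
    with dom show ?thesis by blast
  qed
  show thesis
  proof (rule that[of U V])
    show "openin (top_of_set {0..}) U" unfolding U_def by (intro openin_open_Int open_Int) auto
    show "openin state_space V" unfolding V_def by (rule openin_nbd_state_space[OF s(1) d(1)])
    show "s \<in> U" "p \<in> V" using s a dc(1) self_mem_nbd[OF s(1) d(1)] by (auto simp: U_def V_def)
  qed (use UV in auto)
qed

lemma continuous_maximal_semiflow_state_flow:
  "continuous_maximal_semiflow state_space flow_dom state_flow"
  unfolding continuous_maximal_semiflow_def
proof (intro conjI)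
  show "maximal_semiflow state_space flow_dom state_flow" by (rule maximal_semiflow_state_flow)
  let ?T = "prod_topology (top_of_set {0..}) state_space"
  show "openin ?T flow_dom"
    unfolding openin_prod_topology_alt
  proof (intro allI impI)
    fix s p assume "(s, p) \<in> flow_dom"
    from state_flow_continuous_at[OF this zero_less_one]
    show "\<exists>U V. openin (top_of_set {0..}) U \<and> openin state_space V \<and> s \<in> U \<and> p \<in> V \<and> U \<times> V \<subseteq> flow_dom"
      by metis
  qed
  show "continuous_map (subtopology ?T flow_dom) state_space state_flow"
    unfolding continuous_map_eq_topcontinuous_at topcontinuous_at_def
  proof (intro ballI conjI allI impI)
    fix z assume z: "z \<in> topspace (subtopology ?T flow_dom)"
    then show "z \<in> topspace (subtopology ?T flow_dom)" .
    show "state_flow \<in> topspace (subtopology ?T flow_dom) \<rightarrow> topspace state_space"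
      using state_flow_A unfolding topspace_state_space by auto
    fix W assume W: "openin state_space W \<and> state_flow z \<in> W"
    obtain s p where sp: "z = (s, p)" "(s, p) \<in> flow_dom" using z by (cases z) auto
    have AI: "A \<subseteq> UNIV \<times> cont_maps I" using A_cont_maps by auto
    obtain e where e: "0 < e" "nbd I e (state_flow z) \<inter> A \<subseteq> W"
      using W unfolding openin_subtopology_nbd[OF I AI] by blast
    obtain U V where U: "openin (top_of_set {0..}) U" "openin state_space V" "s \<in> U" "p \<in> V"
      and dom: "U \<times> V \<subseteq> flow_dom"
      and UV: "\<And>s' q. s' \<in> U \<Longrightarrow> q \<in> V \<Longrightarrow> state_flow (s', q) \<in> nbd I e (state_flow (s, p))"
      using state_flow_continuous_at[OF sp(2) e(1)] by metis
    have "openin (subtopology ?T flow_dom) (U \<times> V)"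
      using U(1,2) dom openin_prod_Times_iff[of "top_of_set {0..}" state_space U V]
      unfolding openin_subtopology by blast
    moreover have "state_flow y \<in> W" if y: "y \<in> U \<times> V" for y
    proof -
      have "state_flow y \<in> nbd I e (state_flow z)" using UV y by (auto simp: sp(1))
      moreover have "state_flow y \<in> A" using y dom state_flow_A by auto
      ultimately show ?thesis using e(2) by blast
    qed
    ultimately show "\<exists>U. openin (subtopology ?T flow_dom) U \<and> z \<in> U \<and> (\<forall>y\<in>U. state_flow y \<in> W)"
      using U(3,4) sp(1) by (intro exI[of _ "U \<times> V"]) auto
  qed
qed

text \<open>The locally Lipschitz histories carry the topology of the space of all continuous histories,
  so the neighbourhoods \<open>nbd\<close> describe it.\<close>

lemma state_space_eq: "subtopology (prod_topology euclideanreal (H I)) A = state_space"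
proof -
  have "(topspace euclideanreal \<times> {\<phi>. loc_lipschitz_on I \<phi>}) \<inter> A = A"
    using loc_lipschitz_on_iff_lips[OF I] by (auto simp: A_def)
  then show ?thesis
    by (simp only: prod_topology_subtopology(2) subtopology_subtopology)
qed

theorem maximally_well_posed: "maximally_well_posed_C1 I A F"
  unfolding maximally_well_posed_C1_def
proof (intro exI[of _ lifetime] exI[of _ max_solution] conjI ballI allI)
  fix p assume p: "p \<in> A"
  show "0 < lifetime p" by (rule lifetime_pos[OF p])
  show "maximal_C1_solution I A F p s \<longleftrightarrow>
      s = ({t. fst p \<le> t \<and> ereal t < ereal (fst p) + lifetime p}, max_solution p)" for s
    using maximal_C1_solution_iff[OF p] by (simp add: max_interval_def)
next
  show "continuous_maximal_process (H I) A {(s, p). p \<in> A \<and> 0 \<le> s \<and> ereal s < lifetime p}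
      (\<lambda>(s, t0, \<phi>0). seg I (t0 + s) (max_solution (t0, \<phi>0)))"
    using continuous_maximal_semiflow_state_flow
    unfolding continuous_maximal_process_def state_space_eq flow_dom_def state_flow_def by simp
qed

end

section \<open>Differential equations with state-dependent delay\<close>

lemma lip_le: "M-lipschitz_on S g \<Longrightarrow> lip S g \<le> ereal M"
  unfolding lip_def by (rule Inf_lower) blast

text \<open>The two cases in the definition of almost locally Lipschitzian delays are needed only in a common
  weaker form: for histories that share the constants \<open>N\<close> and differ on \<open>{-1..0}\<close> at most, so that
  their difference has compact support.\<close>

lemma almost_locally_lipschitzian_lips:
  fixes \<tau> :: "real \<times> (real \<Rightarrow> 'a::real_normed_vector) \<Rightarrow> real"
  assumes I: "history_interval I" and al: "almost_locally_lipschitzian I D \<tau>"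
    and p: "p \<in> D" and N: "\<And>k. 0 < N k"
  obtains W L where "openin (prod_topology euclideanreal (Hbar I)) W" "p \<in> W" "0 < L"
    "\<forall>t \<phi>1 \<phi>2 c. (t, \<phi>1) \<in> W \<inter> D \<longrightarrow> (t, \<phi>2) \<in> W \<inter> D \<longrightarrow> lips I N \<phi>1 \<longrightarrow> lips I N \<phi>2 \<longrightarrow>
      (\<forall>\<theta>\<in>I. \<theta> < -1 \<longrightarrow> \<phi>1 \<theta> = \<phi>2 \<theta>) \<longrightarrow> (\<forall>\<theta>\<in>I. norm (\<phi>1 \<theta> - \<phi>2 \<theta>) \<le> c) \<longrightarrow>
      \<bar>\<tau> (t, \<phi>1) - \<tau> (t, \<phi>2)\<bar> \<le> L * c"
proof -
  have sup: "L * (SUP \<theta>\<in>I. norm (\<phi>1 \<theta> - \<phi>2 \<theta>)) \<le> L * c"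
    if "\<forall>\<theta>\<in>I. norm (\<phi>1 \<theta> - \<phi>2 \<theta>) \<le> c" "0 < L" for \<phi>1 \<phi>2 :: "real \<Rightarrow> 'a" and L c :: real
    using that history_intervalD(2)[OF I] by (intro mult_left_mono cSUP_least) auto
  show thesis
  proof (cases "I = {..0}")
    case True
    have all: "\<forall>M::nat \<Rightarrow> real. (\<forall>k\<ge>1. M k > 0) \<longrightarrow>
          (\<exists>W L. openin (prod_topology euclideanreal (Hbar I)) W \<and> p \<in> W \<and> L > 0 \<and>
            (\<forall>t \<phi>1 \<phi>2. (t, \<phi>1) \<in> W \<inter> D \<longrightarrow> (t, \<phi>2) \<in> W \<inter> D \<longrightarrow>
              compact (closure {\<theta>\<in>I. \<phi>1 \<theta> - \<phi>2 \<theta> \<noteq> 0}) \<longrightarrow>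
              (\<forall>k\<ge>1. lip {- real k..0} \<phi>1 \<le> ereal (M k) \<and> lip {- real k..0} \<phi>2 \<le> ereal (M k)) \<longrightarrow>
              \<bar>\<tau> (t, \<phi>1) - \<tau> (t, \<phi>2)\<bar> \<le> L * (SUP \<theta>\<in>I. norm (\<phi>1 \<theta> - \<phi>2 \<theta>))))"
      using al p True unfolding almost_locally_lipschitzian_def by auto
    obtain W L where W: "openin (prod_topology euclideanreal (Hbar I)) W" "p \<in> W" "L > 0"
      and L: "\<And>t \<phi>1 \<phi>2. (t, \<phi>1) \<in> W \<inter> D \<Longrightarrow> (t, \<phi>2) \<in> W \<inter> D \<Longrightarrow>
        compact (closure {\<theta>\<in>I. \<phi>1 \<theta> - \<phi>2 \<theta> \<noteq> 0}) \<Longrightarrow>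
        \<forall>k\<ge>1. lip {- real k..0} \<phi>1 \<le> ereal (N k) \<and> lip {- real k..0} \<phi>2 \<le> ereal (N k) \<Longrightarrow>
        \<bar>\<tau> (t, \<phi>1) - \<tau> (t, \<phi>2)\<bar> \<le> L * (SUP \<theta>\<in>I. norm (\<phi>1 \<theta> - \<phi>2 \<theta>))"
      using mp[OF spec[OF all, of N]] N by blast
    have lipN: "lip {- real k..0} \<phi> \<le> ereal (N k)" if "lips I N \<phi>" for \<phi> :: "real \<Rightarrow> 'a" and k
    proof -
      have "I \<inter> {- real k..0} = {- real k..0}" using True by auto
      then show ?thesis using that by (metis lips_def lip_le)
    qed
    have supp: "compact (closure {\<theta>\<in>I. \<phi>1 \<theta> - \<phi>2 \<theta> \<noteq> 0})"
      if "\<forall>\<theta>\<in>I. \<theta> < -1 \<longrightarrow> \<phi>1 \<theta> = \<phi>2 \<theta>" for \<phi>1 \<phi>2 :: "real \<Rightarrow> 'a"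
    proof -
      have "{\<theta>\<in>I. \<phi>1 \<theta> - \<phi>2 \<theta> \<noteq> 0} \<subseteq> {-1..0}" using that True by force
      then show ?thesis using bounded_subset[OF bounded_closed_interval] by (simp add: compact_closure)
    qed
    show thesis
    proof (rule that[OF W], intro allI impI)
      fix t \<phi>1 \<phi>2 c
      assume *: "(t, \<phi>1) \<in> W \<inter> D" "(t, \<phi>2) \<in> W \<inter> D" "lips I N \<phi>1" "lips I N \<phi>2"
        "\<forall>\<theta>\<in>I. \<theta> < -1 \<longrightarrow> \<phi>1 \<theta> = \<phi>2 \<theta>" "\<forall>\<theta>\<in>I. norm (\<phi>1 \<theta> - \<phi>2 \<theta>) \<le> c"
      have "\<bar>\<tau> (t, \<phi>1) - \<tau> (t, \<phi>2)\<bar> \<le> L * (SUP \<theta>\<in>I. norm (\<phi>1 \<theta> - \<phi>2 \<theta>))"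
        using lipN[OF *(3)] lipN[OF *(4)] by (intro L[OF *(1,2) supp[OF *(5)]]) blast
      also have "\<dots> \<le> L * c" by (rule sup[OF *(6) W(3)])
      finally show "\<bar>\<tau> (t, \<phi>1) - \<tau> (t, \<phi>2)\<bar> \<le> L * c" .
    qed
  next
    case False
    then obtain r where r: "I = {-r..0}" using I by (auto simp: history_interval_def)
    obtain k :: nat where k: "r \<le> real k" using real_arch_simple by blast
    have all: "\<forall>M>0. (\<exists>W L. openin (prod_topology euclideanreal (Hbar I)) W \<and> p \<in> W \<and> L > 0 \<and>
            (\<forall>t \<phi>1 \<phi>2. (t, \<phi>1) \<in> W \<inter> D \<longrightarrow> (t, \<phi>2) \<in> W \<inter> D \<longrightarrow>
              lip I \<phi>1 \<le> ereal M \<longrightarrow> lip I \<phi>2 \<le> ereal M \<longrightarrow>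
              \<bar>\<tau> (t, \<phi>1) - \<tau> (t, \<phi>2)\<bar> \<le> L * (SUP \<theta>\<in>I. norm (\<phi>1 \<theta> - \<phi>2 \<theta>))))"
      using al p False unfolding almost_locally_lipschitzian_def by auto
    obtain W L where W: "openin (prod_topology euclideanreal (Hbar I)) W" "p \<in> W" "L > 0"
      and L: "\<And>t \<phi>1 \<phi>2. (t, \<phi>1) \<in> W \<inter> D \<Longrightarrow> (t, \<phi>2) \<in> W \<inter> D \<Longrightarrow>
        lip I \<phi>1 \<le> ereal (N k) \<Longrightarrow> lip I \<phi>2 \<le> ereal (N k) \<Longrightarrow>
        \<bar>\<tau> (t, \<phi>1) - \<tau> (t, \<phi>2)\<bar> \<le> L * (SUP \<theta>\<in>I. norm (\<phi>1 \<theta> - \<phi>2 \<theta>))"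
      using mp[OF spec[OF all, of "N k"] N] by blast
    have lipN: "lip I \<phi> \<le> ereal (N k)" if "lips I N \<phi>" for \<phi> :: "real \<Rightarrow> 'a"
    proof -
      have "I \<inter> {- real k..0} = I" using r k by auto
      then show ?thesis using that by (metis lips_def lip_le)
    qed
    show thesis
    proof (rule that[OF W], intro allI impI)
      fix t \<phi>1 \<phi>2 c
      assume *: "(t, \<phi>1) \<in> W \<inter> D" "(t, \<phi>2) \<in> W \<inter> D" "lips I N \<phi>1" "lips I N \<phi>2"
        "\<forall>\<theta>\<in>I. norm (\<phi>1 \<theta> - \<phi>2 \<theta>) \<le> c"
      have "\<bar>\<tau> (t, \<phi>1) - \<tau> (t, \<phi>2)\<bar> \<le> L * (SUP \<theta>\<in>I. norm (\<phi>1 \<theta> - \<phi>2 \<theta>))"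
        by (rule L[OF *(1,2) lipN[OF *(3)] lipN[OF *(4)]])
      also have "\<dots> \<le> L * c" by (rule sup[OF *(5) W(3)])
      finally show "\<bar>\<tau> (t, \<phi>1) - \<tau> (t, \<phi>2)\<bar> \<le> L * c" .
    qed
  qed
qed

lemma delay_continuous:
  assumes I: "history_interval I"
    and D: "openin (prod_topology euclideanreal (Hbar I)) D"
    and \<tau>: "continuous_map (subtopology (prod_topology euclideanreal (Hbar I)) D) euclideanreal \<tau>"
    and p: "p \<in> D" and \<epsilon>: "0 < \<epsilon>"
  shows "\<exists>e>0. \<forall>q\<in>nbd I e p. q \<in> D \<and> \<bar>\<tau> q - \<tau> p\<bar> < \<epsilon>"
proof -
  let ?T = "prod_topology euclideanreal (Hbar I)"
  let ?W = "{q \<in> topspace (subtopology ?T D). \<tau> q \<in> ball (\<tau> p) \<epsilon>}"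
  have "openin (subtopology ?T D) ?W"
    by (rule openin_continuous_map_preimage[OF \<tau>]) simp
  then have "openin ?T ?W" using D openin_trans_full by blast
  moreover have "p \<in> ?W" using p \<epsilon> openin_subset[OF D] by auto
  ultimately obtain e where e: "0 < e" "nbd I e p \<subseteq> ?W"
    by (rule nbd_subset_openin[OF I])
  have "q \<in> D \<and> \<bar>\<tau> q - \<tau> p\<bar> < \<epsilon>" if "q \<in> nbd I e p" for q
    using subsetD[OF e(2) that] by (simp add: dist_real_def abs_minus_commute)
  with e(1) show ?thesis by blast
qed

definition delay_args :: "(real \<times> (real \<Rightarrow> 'a) \<Rightarrow> real) \<Rightarrow> real \<times> (real \<Rightarrow> 'a) \<Rightarrow> real \<times> 'a \<times> 'a"
  where "delay_args \<tau> q = (fst q, snd q 0, snd q (- \<tau> q))"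

lemma F_of_delay_args: "F_of f \<tau> q = f (delay_args \<tau> q)"
  by (simp add: F_of_def delay_args_def case_prod_unfold)

lemma dom_F_delay_args: "dom_F domf D \<tau> = {q \<in> D. delay_args \<tau> q \<in> domf}"
  by (auto simp: dom_F_def delay_args_def)

text \<open>Evaluation at the delayed argument is continuous in the compact-open topology: near \<open>p\<close> the
  delays are bounded by \<open>m\<close>, and on \<open>I \<inter> {-m..0}\<close> the histories are uniformly close.\<close>

lemma delay_args_continuous:
  fixes \<tau> :: "real \<times> (real \<Rightarrow> 'a::real_normed_vector) \<Rightarrow> real"
  assumes I: "history_interval I"
    and D: "openin (prod_topology euclideanreal (Hbar I)) D"
    and \<tau>: "continuous_map (subtopology (prod_topology euclideanreal (Hbar I)) D) euclideanreal \<tau>"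
    and \<tau>I: "\<And>q. q \<in> D \<Longrightarrow> - \<tau> q \<in> I"
    and p: "p \<in> D" and \<epsilon>: "0 < \<epsilon>"
  shows "\<exists>e>0. \<forall>q\<in>nbd I e p. q \<in> D \<and> dist (delay_args \<tau> q) (delay_args \<tau> p) < \<epsilon>"
proof -
  obtain t \<phi> where pe: "p = (t, \<phi>)" by (cases p)
  have \<phi>: "continuous_on I \<phi>" using openin_subset[OF D] p by (auto simp: pe cont_maps_def)
  define \<epsilon>' where "\<epsilon>' = \<epsilon> / 4"
  have \<epsilon>': "0 < \<epsilon>'" using \<epsilon> by (simp add: \<epsilon>'_def)
  obtain d where d: "0 < d" "\<And>\<theta>. \<theta> \<in> I \<Longrightarrow> dist \<theta> (- \<tau> p) < d \<Longrightarrow> dist (\<phi> \<theta>) (\<phi> (- \<tau> p)) < \<epsilon>'"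
    using \<phi> \<tau>I[OF p] \<epsilon>' unfolding continuous_on_iff by metis
  have "0 < min d 1" using d by simp
  then obtain e1 where e1: "0 < e1" "\<And>q. q \<in> nbd I e1 p \<Longrightarrow> q \<in> D \<and> \<bar>\<tau> q - \<tau> p\<bar> < min d 1"
    using delay_continuous[OF I D \<tau> p] by metis
  define m where "m = \<bar>\<tau> p\<bar> + 1"
  define e where "e = Min {e1, \<epsilon>', 1 / m}"
  have m: "0 < m" by (simp add: m_def)
  have e: "0 < e" "e \<le> e1" "e \<le> \<epsilon>'" "e \<le> 1 / m" using e1(1) \<epsilon>' m by (auto simp: e_def)
  have me: "m \<le> 1 / e" using e m by (simp add: field_simps)
  have "q \<in> D \<and> dist (delay_args \<tau> q) (delay_args \<tau> p) < \<epsilon>" if q: "q \<in> nbd I e p" for q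
  proof -
    obtain s \<psi> where qe: "q = (s, \<psi>)" by (cases q)
    have qD: "q \<in> D" and \<tau>d: "\<bar>\<tau> q - \<tau> p\<bar> < d" "\<bar>\<tau> q - \<tau> p\<bar> < 1"
      using e1(2)[of q] subsetD[OF nbd_mono[OF e(1,2)] q] by auto
    have near: "dist (\<psi> \<theta>) (\<phi> \<theta>) < \<epsilon>'" if "\<theta> \<in> I" "- m \<le> \<theta>" for \<theta>
    proof -
      have "- (1 / e) \<le> \<theta>" using that me by linarith
      then have "dist (\<psi> \<theta>) (\<phi> \<theta>) < e" using q that(1) unfolding qe pe nbd_def by simp
      then show ?thesis using e(3) by linarith
    qed
    have 1: "dist s t < \<epsilon>'" using q e(3) unfolding qe pe nbd_def by simp
    have 2: "dist (\<psi> 0) (\<phi> 0) < \<epsilon>'" using history_intervalD(2)[OF I] m by (intro near) auto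
    have "dist (\<psi> (- \<tau> q)) (\<phi> (- \<tau> q)) < \<epsilon>'"
      using \<tau>d(2) by (intro near \<tau>I[OF qD]) (simp add: m_def)
    moreover have "dist (\<phi> (- \<tau> q)) (\<phi> (- \<tau> p)) < \<epsilon>'"
      using \<tau>d(1) by (intro d(2) \<tau>I[OF qD]) (simp add: dist_real_def)
    ultimately have 3: "dist (\<psi> (- \<tau> q)) (\<phi> (- \<tau> p)) < 2 * \<epsilon>'"
      using dist_triangle[of "\<psi> (- \<tau> q)" "\<phi> (- \<tau> p)" "\<phi> (- \<tau> q)"] by linarith
    have "dist (delay_args \<tau> q) (delay_args \<tau> p) \<le>
        dist s t + (dist (\<psi> 0) (\<phi> 0) + dist (\<psi> (- \<tau> q)) (\<phi> (- \<tau> p)))"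
    proof -
      have pr: "dist (a, b) (a', b') \<le> dist a a' + dist b b'" for a a' :: "'x::metric_space" and b b' :: "'y::metric_space"
        unfolding dist_Pair_Pair by (intro sqrt_sum_squares_le_sum) auto
      show ?thesis
        using pr[of s "(\<psi> 0, \<psi> (- \<tau> q))" t "(\<phi> 0, \<phi> (- \<tau> p))"]
          pr[of "\<psi> 0" "\<psi> (- \<tau> q)" "\<phi> 0" "\<phi> (- \<tau> p)"]
        unfolding delay_args_def qe pe fst_conv snd_conv by linarith
    qed
    then show ?thesis using qD 1 2 3 unfolding \<epsilon>'_def by linarith
  qed
  with e(1) show ?thesis by blast
qed

text \<open>The Lipschitz estimate for \<open>F_of f \<tau>\<close> splits the change of the delayed value \<open>\<phi> (- \<tau>)\<close>: the
  change of the history contributes \<open>c\<close>, while the change of the delay contributes the Lipschitz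
  constant \<open>N k\<close> of the history times the change of \<open>\<tau>\<close>. This second term is the reason why \<open>F\<close>
  is Lipschitz only along histories with prescribed Lipschitz constants.\<close>

lemma delay_problem_state_dependent:
  fixes f :: "real \<times> 'a::euclidean_space \<times> 'a \<Rightarrow> 'a"
  assumes I: "history_interval I"
    and f: "continuous_on domf f" "open domf" and f_lip: "locally_lipschitzian domf f"
    and D: "openin (prod_topology euclideanreal (Hbar I)) D"
    and \<tau>: "continuous_map (subtopology (prod_topology euclideanreal (Hbar I)) D) euclideanreal \<tau>"
    and \<tau>I: "\<And>q. q \<in> D \<Longrightarrow> - \<tau> q \<in> I"
    and \<tau>_lip: "almost_locally_lipschitzian I D \<tau>"
  shows "delay_problem I (dom_F domf D \<tau>) (F_of f \<tau>)"
proof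
  show "history_interval I" by (rule I)
  show "\<phi> \<in> cont_maps I" if "(t, \<phi>) \<in> dom_F domf D \<tau>" for t \<phi>
    using that openin_subset[OF D] by (auto simp: dom_F_def)
  note args = delay_args_continuous[OF I D \<tau> \<tau>I]
  have pD: "p \<in> D" "delay_args \<tau> p \<in> domf" if "p \<in> dom_F domf D \<tau>" for p
    using that by (auto simp: dom_F_delay_args)
  fix p assume p: "p \<in> dom_F domf D \<tau>"
  obtain d0 where d0: "0 < d0" "\<And>z. dist z (delay_args \<tau> p) < d0 \<Longrightarrow> z \<in> domf"
    using f(2) pD(2)[OF p] unfolding open_dist by metis
  show "\<exists>e>0. \<forall>q\<in>nbd I e p. q \<in> dom_F domf D \<tau> \<and> dist (F_of f \<tau> q) (F_of f \<tau> p) < \<epsilon>"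
    if \<epsilon>: "0 < \<epsilon>" for \<epsilon>
  proof -
    obtain d where d: "0 < d" "\<And>z. z \<in> domf \<Longrightarrow> dist z (delay_args \<tau> p) < d \<Longrightarrow>
        dist (f z) (f (delay_args \<tau> p)) < \<epsilon>"
      using f(1) pD(2)[OF p] \<epsilon> unfolding continuous_on_iff by metis
    have "0 < min d d0" using d d0 by simp
    then obtain e where "0 < e" "\<And>q. q \<in> nbd I e p \<Longrightarrow> q \<in> D \<and>
        dist (delay_args \<tau> q) (delay_args \<tau> p) < min d d0"
      using args[OF _ pD(1)[OF p]] by metis
    then show ?thesis
      using d0(2) d(2) by (intro exI[of _ e]) (auto simp: dom_F_delay_args F_of_delay_args)
  qed
  show "\<exists>e>0. \<exists>L\<ge>0. \<forall>t \<phi>1 \<phi>2 c. (t, \<phi>1) \<in> nbd I e p \<longrightarrow> (t, \<phi>2) \<in> nbd I e p \<longrightarrow>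
      lips I N \<phi>1 \<longrightarrow> lips I N \<phi>2 \<longrightarrow> (\<forall>\<theta>\<in>I. \<theta> < -1 \<longrightarrow> \<phi>1 \<theta> = \<phi>2 \<theta>) \<longrightarrow>
      (\<forall>\<theta>\<in>I. norm (\<phi>1 \<theta> - \<phi>2 \<theta>) \<le> c) \<longrightarrow>
      norm (F_of f \<tau> (t, \<phi>1) - F_of f \<tau> (t, \<phi>2)) \<le> L * c"
    if N: "\<And>k. 0 < N k" for N :: "nat \<Rightarrow> real"
  proof -
    obtain U Lf where U: "openin (top_of_set domf) U" "delay_args \<tau> p \<in> U" and Lf: "0 < Lf"
      and f_le: "\<And>t x1 y1 x2 y2. (t, x1, y1) \<in> U \<Longrightarrow> (t, x2, y2) \<in> U \<Longrightarrow>
        norm (f (t, x1, y1) - f (t, x2, y2)) \<le> Lf * (norm (x1 - x2) + norm (y1 - y2))"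
      using f_lip pD(2)[OF p] unfolding locally_lipschitzian_def by meson
    have "open U" using U(1) f(2) openin_open_eq by blast
    then obtain d where d: "0 < d" "\<And>z. dist z (delay_args \<tau> p) < d \<Longrightarrow> z \<in> U"
      using U(2) unfolding open_dist by metis
    obtain e1 where e1: "0 < e1" "\<And>q. q \<in> nbd I e1 p \<Longrightarrow> q \<in> D \<and>
        dist (delay_args \<tau> q) (delay_args \<tau> p) < d"
      using args[OF _ pD(1)[OF p] d(1)] by metis
    obtain W L\<tau> where W: "openin (prod_topology euclideanreal (Hbar I)) W" "p \<in> W" and L\<tau>: "0 < L\<tau>"
      and \<tau>_le: "\<forall>t \<phi>1 \<phi>2 c. (t, \<phi>1) \<in> W \<inter> D \<longrightarrow> (t, \<phi>2) \<in> W \<inter> D \<longrightarrow> lips I N \<phi>1 \<longrightarrow> lips I N \<phi>2 \<longrightarrow>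
        (\<forall>\<theta>\<in>I. \<theta> < -1 \<longrightarrow> \<phi>1 \<theta> = \<phi>2 \<theta>) \<longrightarrow> (\<forall>\<theta>\<in>I. norm (\<phi>1 \<theta> - \<phi>2 \<theta>) \<le> c) \<longrightarrow>
        \<bar>\<tau> (t, \<phi>1) - \<tau> (t, \<phi>2)\<bar> \<le> L\<tau> * c"
      by (rule almost_locally_lipschitzian_lips[where N = N, OF I \<tau>_lip pD(1)[OF p] N])
    obtain e2 where e2: "0 < e2" "nbd I e2 p \<subseteq> W" by (rule nbd_subset_openin[OF I W])
    obtain e3 where e3: "0 < e3" "\<And>q. q \<in> nbd I e3 p \<Longrightarrow> \<bar>\<tau> q - \<tau> p\<bar> < 1"
      using delay_continuous[OF I D \<tau> pD(1)[OF p] zero_less_one] by metis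
    obtain k :: nat where k: "\<tau> p + 1 \<le> real k" using real_arch_simple by blast
    define e where "e = Min {e1, e2, e3}"
    have e: "0 < e" "e \<le> e1" "e \<le> e2" "e \<le> e3" using e1 e2 e3 by (auto simp: e_def)
    define L where "L = Lf * (2 + N k * L\<tau>)"
    have L0: "0 \<le> L" unfolding L_def using Lf N[of k] L\<tau> by simp
    have "norm (F_of f \<tau> (t, \<phi>1) - F_of f \<tau> (t, \<phi>2)) \<le> L * c"
      if q: "(t, \<phi>1) \<in> nbd I e p" "(t, \<phi>2) \<in> nbd I e p" and lips: "lips I N \<phi>1" "lips I N \<phi>2"
        and eq: "\<forall>\<theta>\<in>I. \<theta> < -1 \<longrightarrow> \<phi>1 \<theta> = \<phi>2 \<theta>" and c: "\<forall>\<theta>\<in>I. norm (\<phi>1 \<theta> - \<phi>2 \<theta>) \<le> c"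
      for t \<phi>1 \<phi>2 c
    proof -
      define \<tau>1 \<tau>2 where "\<tau>1 = \<tau> (t, \<phi>1)" and "\<tau>2 = \<tau> (t, \<phi>2)"
      have inD: "(t, \<phi>1) \<in> D" "(t, \<phi>2) \<in> D"
        and inU: "delay_args \<tau> (t, \<phi>1) \<in> U" "delay_args \<tau> (t, \<phi>2) \<in> U"
        using e1(2) d(2) subsetD[OF nbd_mono[OF e(1,2)]] q by blast+
      have inW: "(t, \<phi>1) \<in> W" "(t, \<phi>2) \<in> W"
        using e2(2) subsetD[OF nbd_mono[OF e(1,3)]] q by blast+
      have near: "\<bar>\<tau>1 - \<tau> p\<bar> < 1" "\<bar>\<tau>2 - \<tau> p\<bar> < 1"
        using e3(2) subsetD[OF nbd_mono[OF e(1,4)]] q unfolding \<tau>1_def \<tau>2_def by blast+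
      have \<tau>sI: "- \<tau>1 \<in> I" "- \<tau>2 \<in> I" using \<tau>I inD by (auto simp: \<tau>1_def \<tau>2_def)
      have dom: "- \<tau>1 \<in> I \<inter> {- real k..0}" "- \<tau>2 \<in> I \<inter> {- real k..0}"
        using \<tau>sI near k history_intervalD(3)[OF I \<tau>sI(1)] history_intervalD(3)[OF I \<tau>sI(2)] by auto
      have "norm (\<phi>1 (- \<tau>1) - \<phi>1 (- \<tau>2)) \<le> N k * \<bar>\<tau>1 - \<tau>2\<bar>"
        using lipschitz_onD[of "N k" _ \<phi>1, OF _ dom] lips(1)
        by (simp add: lips_def dist_norm abs_minus_commute)
      also have "\<dots> \<le> N k * (L\<tau> * c)"
        using \<tau>_le[rule_format, OF IntI[OF inW(1) inD(1)] IntI[OF inW(2) inD(2)] lips] eq c N[of k]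
        by (intro mult_left_mono) (auto simp: \<tau>1_def \<tau>2_def)
      finally have "norm (\<phi>1 (- \<tau>1) - \<phi>1 (- \<tau>2)) \<le> N k * (L\<tau> * c)" .
      moreover have "norm (\<phi>1 (- \<tau>2) - \<phi>2 (- \<tau>2)) \<le> c" using c \<tau>sI by blast
      ultimately have "norm (\<phi>1 (- \<tau>1) - \<phi>2 (- \<tau>2)) \<le> N k * (L\<tau> * c) + c"
        using norm_triangle_ineq[of "\<phi>1 (- \<tau>1) - \<phi>1 (- \<tau>2)" "\<phi>1 (- \<tau>2) - \<phi>2 (- \<tau>2)"] by simp
      moreover have "norm (\<phi>1 0 - \<phi>2 0) \<le> c" using c history_intervalD(2)[OF I] by blast
      ultimately have "Lf * (norm (\<phi>1 0 - \<phi>2 0) + norm (\<phi>1 (- \<tau>1) - \<phi>2 (- \<tau>2))) \<le>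
          Lf * (c + (N k * (L\<tau> * c) + c))"
        using Lf by (intro mult_left_mono) auto
      moreover have "norm (F_of f \<tau> (t, \<phi>1) - F_of f \<tau> (t, \<phi>2)) \<le>
          Lf * (norm (\<phi>1 0 - \<phi>2 0) + norm (\<phi>1 (- \<tau>1) - \<phi>2 (- \<tau>2)))"
        using f_le inU by (simp add: F_of_delay_args delay_args_def \<tau>1_def \<tau>2_def)
      ultimately show ?thesis by (simp add: L_def algebra_simps)
    qed
    with e(1) L0 show ?thesis by blast
  qed
qed

lemma maximally_well_posed_C1_cong:
  assumes "\<And>p. p \<in> A \<Longrightarrow> F p = G p"
  shows "maximally_well_posed_C1 I A F \<longleftrightarrow> maximally_well_posed_C1 I A G"
proof -
  have "solution I A F = solution I A G"
    unfolding solution_def using assms by (intro ext) (auto split: prod.splits)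
  then have "C1_solution I A F = C1_solution I A G"
    by (simp add: C1_solution_def fun_eq_iff)
  then have "maximal_C1_solution I A F = maximal_C1_solution I A G"
    by (simp add: maximal_C1_solution_def fun_eq_iff)
  then show ?thesis by (simp add: maximally_well_posed_C1_def)
qed

theorem corollary7p9:
  fixes I :: "real set"
    and f :: "real \<times> (real ^ 'n) \<times> (real ^ 'n) \<Rightarrow> real ^ 'n"
    and domf :: "(real \<times> (real ^ 'n) \<times> (real ^ 'n)) set"
    and \<tau> \<tau>bar :: "real \<times> (real \<Rightarrow> real ^ 'n) \<Rightarrow> real"
    and D Dbar :: "(real \<times> (real \<Rightarrow> real ^ 'n)) set"
  assumes I: "(\<exists>r>0. I = {-r..0}) \<or> I = {..0}"
    and D: "D \<subseteq> UNIV \<times> topspace (H I)"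
    and \<tau>: "\<And>p. p \<in> D \<Longrightarrow> 0 \<le> \<tau> p \<and> \<tau> p \<in> uminus ` I"
    and f: "continuous_on domf f" "open domf"
    and Dbar: "openin (prod_topology euclideanreal (Hbar I)) Dbar"
    and \<tau>bar: "\<And>p. p \<in> Dbar \<Longrightarrow> 0 \<le> \<tau>bar p \<and> \<tau>bar p \<in> uminus ` I"
    and \<tau>bar_cont: "continuous_map (subtopology (prod_topology euclideanreal (Hbar I)) Dbar)
      euclideanreal \<tau>bar"
    and D_eq: "D = Dbar \<inter> (UNIV \<times> topspace (H I))"
    and extends: "\<And>p. p \<in> D \<Longrightarrow> \<tau>bar p = \<tau> p"
    and f_lip: "locally_lipschitzian domf f"
    and \<tau>bar_lip: "almost_locally_lipschitzian I Dbar \<tau>bar"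
  shows "maximally_well_posed_C1 I (dom_F domf D \<tau>) (F_of f \<tau>)"
proof -
  have hI: "history_interval I" using I by (simp add: history_interval_def)
  have "- \<tau>bar q \<in> I" if "q \<in> Dbar" for q using \<tau>bar[OF that] by force
  then interpret delay_problem I "dom_F domf Dbar \<tau>bar" "F_of f \<tau>bar"
    by (intro delay_problem_state_dependent hI f f_lip Dbar \<tau>bar_cont \<tau>bar_lip)
  have args: "delay_args \<tau>bar p = delay_args \<tau> p" if "p \<in> D" for p
    using extends[OF that] by (simp add: delay_args_def)
  have "(t, \<phi>) \<in> D \<longleftrightarrow> (t, \<phi>) \<in> Dbar \<and> (\<exists>N. lips I N \<phi>)" for t \<phi>
    using openin_subset[OF Dbar] loc_lipschitz_on_iff_lips[OF hI, of \<phi>] by (auto simp: D_eq)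
  then have "A = {q \<in> D. delay_args \<tau>bar q \<in> domf}"
    unfolding A_def unfolding dom_F_delay_args by auto
  also have "\<dots> = dom_F domf D \<tau>"
    unfolding dom_F_delay_args by (rule Collect_cong) (metis args)
  finally have "A = dom_F domf D \<tau>" .
  moreover have "F_of f \<tau>bar p = F_of f \<tau> p" if "p \<in> dom_F domf D \<tau>" for p
    using that args by (simp add: F_of_delay_args dom_F_delay_args)
  ultimately show ?thesis
    using maximally_well_posed maximally_well_posed_C1_cong[of "dom_F domf D \<tau>" "F_of f \<tau>bar" "F_of f \<tau>" I]
    by simp
qed

end
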